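(* Let $n\geq 0$. The symmetric group $S_n$ on the color set $C(N)$ acts on the colorful $n$-associahedron $\mathcal{A}^{c}_n$ by automorphisms via $\sigma((C,t)) = (\sigma(C),t_\sigma)$, and the quotient $\mathcal{A}^{c}_n/S_n$ is isomorphic (as a partially ordered set) to the face lattice of the ordinary $n$-associahedron $\mathcal{A}_n$.
   Context: Let $N$ be a convex $(n+3)$-gon with vertices $1,\ldots,n+3$ in cyclic order, $C(N)$ an $n$-element color set. A colored triangulation of $N$ is a triangulation of $N$ (with $n$ diagonals) whose diagonals carry pairwise distinct colors from $C(N)$; flipping a diagonal replaces it by the other diagonal of the quadrilateral formed by its two adjacent triangles, keeping the color. $\mathcal{G}^{c}_n$ is the graph on colored triangulations with adjacency by single flips, edges colored by the color of the flipped diagonal. For $C\subseteq C(N)$, $t\sim_C t'$ means $t'$ is reachable from $t$ by flips of diagonals with colors in $C$ only. The colorful associahedron $\mathcal{A}^{c}_n$ is the poset consisting of a least element (rank $-1$) and the faces $(C,t)$ of rank $|C|$, where $(C,t)$ denotes the $\sim_C$-class of the colored triangulation $t$ (recorded together with $C$), ordered by $(C,X)\le (C',X')$ iff $C\subseteq C'$ and $X\subseteq X'$. For $\sigma\in S_n$ (permutations of $C(N)$), $t_\sigma$ is the colored triangulation with the same underlying triangulation as $t$ in which each color $c$ is replaced by $\sigma(c)$. The quotient $\mathcal{A}^{c}_n/S_n$ is the poset of $S_n$-orbits of faces, where orbit $O\le O'$ iff there exist $F\in O$, $F'\in O'$ with $F\le F'$. The face lattice of the ordinary associahedron $\mathcal{A}_n$: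 its vertices are the (uncolored) triangulations of $N$; for $j=0,\ldots,n$, its $j$-faces correspond to sets of $n-j$ pairwise non-crossing diagonals of $N$, the vertex set of such a face being all triangulations containing those diagonals; faces are ordered by inclusion of vertex sets, with an added empty face of rank $-1$. *)

theory Defs
  imports "HOL-Algebra.Group_Action"
begin

text \<open>
  The convex polygon with \<open>n + 3\<close> vertices is treated combinatorially: a segment is the
  two-element set of its end points, and two diagonals meet in an interior point iff their end
  points strictly interleave in the cyclic order.
\<close>

definition polygon_vertices :: "nat \<Rightarrow> nat set"
  where "polygon_vertices n = {1..n + 3}"

definition polygon_sides :: "nat \<Rightarrow> nat set set"
  where "polygon_sides n = {{i, i + 1} | i. 1 \<le> i \<and> i \<le> n + 2} \<union> {{n + 3, 1}}"

definition diagonals :: "nat \<Rightarrow> nat set set"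
  where "diagonals n =
    {{i, j} | i j. i \<in> polygon_vertices n \<and> j \<in> polygon_vertices n \<and> i \<noteq> j} - polygon_sides n"

definition crossing :: "nat set \<Rightarrow> nat set \<Rightarrow> bool"
  where "crossing d e \<longleftrightarrow>
    (\<exists>a b a' b'. a < b \<and> b < a' \<and> a' < b' \<and>
      (d = {a, a'} \<and> e = {b, b'} \<or> d = {b, b'} \<and> e = {a, a'}))"

definition noncrossing_sets :: "nat \<Rightarrow> nat set set set"
  where "noncrossing_sets n = {D. D \<subseteq> diagonals n \<and> (\<forall>d\<in>D. \<forall>e\<in>D. \<not> crossing d e)}"

text \<open>
  A triangulation is an inclusion-maximal set of pairwise non-crossing diagonals; it has exactly
  \<open>n\<close> elements.
\<close>

definition triangulations :: "nat \<Rightarrow> nat set set set"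
  where "triangulations n =
    {T \<in> noncrossing_sets n. \<forall>D\<in>noncrossing_sets n. T \<subseteq> D \<longrightarrow> D = T}"

text \<open>
  As no vertex lies in the interior of the polygon, any three vertices that are pairwise joined
  by sides or by diagonals of a triangulation \<open>T\<close> span one of the triangles of \<open>T\<close>.
\<close>

definition triangles :: "nat \<Rightarrow> nat set set \<Rightarrow> nat set set"
  where "triangles n T =
    {\<Delta>. \<Delta> \<subseteq> polygon_vertices n \<and> card \<Delta> = 3 \<and>
        (\<forall>i\<in>\<Delta>. \<forall>j\<in>\<Delta>. i \<noteq> j \<longrightarrow> {i, j} \<in> polygon_sides n \<union> T)}"

text \<open>
  The two triangles adjacent to \<open>d\<close> share the end points of \<open>d\<close>; the other diagonal \<open>d'\<close> of the
  quadrilateral which they form joins its two remaining corners.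
\<close>

definition flips_to :: "nat \<Rightarrow> nat set set \<Rightarrow> nat set \<Rightarrow> nat set \<Rightarrow> bool"
  where "flips_to n T d d' \<longleftrightarrow> d \<in> T \<and>
    (\<exists>\<Delta>\<in>triangles n T. \<exists>\<Delta>'\<in>triangles n T.
      \<Delta> \<noteq> \<Delta>' \<and> d = \<Delta> \<inter> \<Delta>' \<and> d' = (\<Delta> \<union> \<Delta>') - d)"

text \<open>
  A colored triangulation is encoded as a partial map: its domain is the underlying
  triangulation, its values are the colors.
\<close>

type_synonym 'c coloring = "nat set \<rightharpoonup> 'c"

definition colored_triangulations :: "nat \<Rightarrow> 'c set \<Rightarrow> 'c coloring set"
  where "colored_triangulations n K =
    {t. dom t \<in> triangulations n \<and> ran t \<subseteq> K \<and> inj_on t (dom t)}"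

definition colored_flips :: "nat \<Rightarrow> 'c set \<Rightarrow> 'c set \<Rightarrow> 'c coloring rel"
  where "colored_flips n K C =
    {(t, t'). t \<in> colored_triangulations n K \<and> t' \<in> colored_triangulations n K \<and>
      (\<exists>c\<in>C. \<exists>d d'. t d = Some c \<and> flips_to n (dom t) d d' \<and> t' = t(d := None, d' := Some c))}"

definition flip_class :: "nat \<Rightarrow> 'c set \<Rightarrow> 'c set \<Rightarrow> 'c coloring \<Rightarrow> 'c coloring set"
  where "flip_class n K C t = {t'. (t, t') \<in> (colored_flips n K C)\<^sup>*}"

text \<open>The least element of the colorful associahedron is \<open>None\<close>.\<close>

type_synonym 'c colorful_face = "('c set \<times> 'c coloring set) option"

definition colorful_face :: "nat \<Rightarrow> 'c set \<Rightarrow> 'c set \<Rightarrow> 'c coloring \<Rightarrow> 'c colorful_face"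
  where "colorful_face n K C t = Some (C, flip_class n K C t)"

definition colorful_faces :: "nat \<Rightarrow> 'c set \<Rightarrow> 'c colorful_face set"
  where "colorful_faces n K =
    insert None {colorful_face n K C t | C t. C \<subseteq> K \<and> t \<in> colored_triangulations n K}"

definition colorful_order :: "nat \<Rightarrow> 'c set \<Rightarrow> 'c colorful_face rel"
  where "colorful_order n K =
    {(F, F'). F \<in> colorful_faces n K \<and> F' \<in> colorful_faces n K \<and>
      (F = None \<or>
       (\<exists>C X C' X'. F = Some (C, X) \<and> F' = Some (C', X') \<and> C \<subseteq> C' \<and> X \<subseteq> X'))}"

lemma partial_order_colorful: "partial_order_on (colorful_faces n K) (colorful_order n K)"
proof -
  have "colorful_order n K \<subseteq> colorful_faces n K \<times> colorful_faces n K"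
    by (auto simp: colorful_order_def)
  moreover have "refl_on (colorful_faces n K) (colorful_order n K)"
    by (rule refl_onI) (auto simp: colorful_order_def colorful_faces_def colorful_face_def)
  moreover have "trans (colorful_order n K)"
  proof (rule transI)
    fix F G H assume "(F, G) \<in> colorful_order n K" and "(G, H) \<in> colorful_order n K"
    then show "(F, H) \<in> colorful_order n K"
      by (cases F; cases G; cases H) (auto simp: colorful_order_def subset_iff)
  qed
  moreover have "antisym (colorful_order n K)"
    by (rule antisymI) (auto simp: colorful_order_def)
  ultimately show ?thesis
    by (simp add: partial_order_on_def preorder_on_def)
qed

definition recolor :: "('c \<Rightarrow> 'c) \<Rightarrow> 'c coloring \<Rightarrow> 'c coloring"
  where "recolor \<sigma> t = map_option \<sigma> \<circ> t"

text \<open>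
  The action is given on the class itself rather than on a representative. It is restricted to
  the faces because the elements of \<^const>\<open>BijGroup\<close> are extensional functions.
\<close>

definition face_action :: "nat \<Rightarrow> 'c set \<Rightarrow> ('c \<Rightarrow> 'c) \<Rightarrow> 'c colorful_face \<Rightarrow> 'c colorful_face"
  where "face_action n K \<sigma> =
    (\<lambda>F\<in>colorful_faces n K. map_option (\<lambda>(C, X). (\<sigma> ` C, recolor \<sigma> ` X)) F)"

definition quotient_faces :: "nat \<Rightarrow> 'c set \<Rightarrow> 'c colorful_face set set"
  where "quotient_faces n K = orbits (BijGroup K) (colorful_faces n K) (face_action n K)"

definition quotient_order :: "nat \<Rightarrow> 'c set \<Rightarrow> 'c colorful_face set rel"
  where "quotient_order n K =
    {(P, Q). P \<in> quotient_faces n K \<and> Q \<in> quotient_faces n K \<and>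
      (\<exists>F\<in>P. \<exists>F'\<in>Q. (F, F') \<in> colorful_order n K)}"

text \<open>Faces of the ordinary associahedron are represented by their vertex sets.\<close>

definition associahedron_faces :: "nat \<Rightarrow> nat set set set set"
  where "associahedron_faces n =
    insert {} {{T \<in> triangulations n. D \<subseteq> T} | D j.
      j \<le> n \<and> D \<in> noncrossing_sets n \<and> card D = n - j}"

definition associahedron_order :: "nat \<Rightarrow> nat set set set rel"
  where "associahedron_order n =
    {(\<Phi>, \<Psi>). \<Phi> \<in> associahedron_faces n \<and> \<Psi> \<in> associahedron_faces n \<and> \<Phi> \<subseteq> \<Psi>}"

definition poset_iso :: "'a set \<Rightarrow> 'a rel \<Rightarrow> 'b set \<Rightarrow> 'b rel \<Rightarrow> ('a \<Rightarrow> 'b) \<Rightarrow> bool"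
  where "poset_iso A r B s f \<longleftrightarrow>
    bij_betw f A B \<and> (\<forall>x\<in>A. \<forall>y\<in>A. (x, y) \<in> r \<longleftrightarrow> (f x, f y) \<in> s)"

end

theory Submission
  imports Defs
begin

text \<open>
  Forgetting the colors of the vertices of a face \<open>(C, t)\<close> leaves precisely the triangulations that
  contain the diagonals of \<open>t\<close> with a color outside of \<open>C\<close>. One inclusion is clear, as these
  diagonals are never flipped; the other one is the connectedness of the flip graph on the
  triangulations containing a given set \<open>D\<close>, since colors are carried along a path of flips.
  Conversely, two colorings of the same triangulation differ by a unique permutation of the colors,
  because a triangulation has exactly as many diagonals as there are colors. Hence the orbit of a
  face is determined by its set of triangulations, and inclusions between such sets lift to faces.

  For the connectedness, every triangulation containing \<open>D\<close> can be flipped down to the unique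
  one that admits no decreasing flip outside of \<open>D\<close>, in the sense of the Tamari order.
\<close>

section \<open>Triangulations of a convex polygon\<close>

text \<open>Sides count as edges so that all three segments of a triangle are treated alike. Listing
  the smaller end point first turns crossings into chains of inequalities.\<close>

definition edge :: "nat \<Rightarrow> nat set set \<Rightarrow> nat \<Rightarrow> nat \<Rightarrow> bool"
  where "edge n T i j \<longleftrightarrow> i < j \<and> {i, j} \<in> polygon_sides n \<union> T"

lemma polygon_sides_iff:
  assumes "i < j"
  shows "{i, j} \<in> polygon_sides n \<longleftrightarrow> 1 \<le> i \<and> j \<le> n + 3 \<and> (j = i + 1 \<or> i = 1 \<and> j = n + 3)"
  using assms by (auto simp: polygon_sides_def doubleton_eq_iff)

lemma diagonals_iff:
  assumes "i < j"
  shows "{i, j} \<in> diagonals n \<longleftrightarrow> 1 \<le> i \<and> i + 2 \<le> j \<and> j \<le> n + 3 \<and> \<not> (i = 1 \<and> j = n + 3)"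
proof -
  have "{i, j} \<in> {{i, j} |i j. i \<in> polygon_vertices n \<and> j \<in> polygon_vertices n \<and> i \<noteq> j} \<longleftrightarrow>
    1 \<le> i \<and> j \<le> n + 3"
    using assms by (fastforce simp: polygon_vertices_def doubleton_eq_iff)
  then show ?thesis
    unfolding diagonals_def using polygon_sides_iff[OF assms, of n] assms by auto
qed

lemma diagonalsE:
  assumes "d \<in> diagonals n"
  obtains i j where "d = {i, j}" and "i < j"
  using assms unfolding diagonals_def by (auto simp: insert_commute) (metis insert_commute linorder_neqE_nat)

lemma crossing_iff:
  assumes "i < j" and "k < l"
  shows "crossing {i, j} {k, l} \<longleftrightarrow> i < k \<and> k < j \<and> j < l \<or> k < i \<and> i < l \<and> l < j"
proof
  assume "crossing {i, j} {k, l}"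
  then obtain a b a' b' where "a < b" "b < a'" "a' < b'"
    and "{i, j} = {a, a'} \<and> {k, l} = {b, b'} \<or> {i, j} = {b, b'} \<and> {k, l} = {a, a'}"
    unfolding crossing_def by blast
  then show "i < k \<and> k < j \<and> j < l \<or> k < i \<and> i < l \<and> l < j"
    using assms by (auto simp: doubleton_eq_iff)
next
  assume "i < k \<and> k < j \<and> j < l \<or> k < i \<and> i < l \<and> l < j"
  then show "crossing {i, j} {k, l}"
    unfolding crossing_def by blast
qed

lemma crossing_sym: "crossing d e \<longleftrightarrow> crossing e d"
  unfolding crossing_def by blast

lemma finite_diagonals: "finite (diagonals n)"
proof (rule finite_subset)
  show "diagonals n \<subseteq> Pow (polygon_vertices n)"
    by (auto simp: diagonals_def)
qed (simp add: polygon_vertices_def)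

lemma finite_noncrossing: "D \<in> noncrossing_sets n \<Longrightarrow> finite D"
  unfolding noncrossing_sets_def using finite_diagonals finite_subset by blast

lemma noncrossing_subset: "D \<in> noncrossing_sets n \<Longrightarrow> D' \<subseteq> D \<Longrightarrow> D' \<in> noncrossing_sets n"
  unfolding noncrossing_sets_def by blast

lemma triangulation_noncrossing: "T \<in> triangulations n \<Longrightarrow> T \<in> noncrossing_sets n"
  unfolding triangulations_def by blast

lemma triangulation_maximal:
  "T \<in> triangulations n \<Longrightarrow> D \<in> noncrossing_sets n \<Longrightarrow> T \<subseteq> D \<Longrightarrow> D = T"
  unfolding triangulations_def by blast

lemma noncrossing_extends:
  assumes "D \<in> noncrossing_sets n"
  obtains T where "T \<in> triangulations n" and "D \<subseteq> T"
proof -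
  have "noncrossing_sets n \<subseteq> Pow (diagonals n)"
    by (auto simp: noncrossing_sets_def)
  then have "finite (noncrossing_sets n)"
    using finite_diagonals finite_subset by blast
  from finite_has_maximal2[OF this assms] obtain T
    where "T \<in> noncrossing_sets n" "D \<subseteq> T" "\<forall>S\<in>noncrossing_sets n. T \<subseteq> S \<longrightarrow> T = S"
    by blast
  then show ?thesis
    using that[of T] unfolding triangulations_def by auto
qed

lemma edge_bounds:
  assumes "T \<in> noncrossing_sets n" and "edge n T i j"
  shows "1 \<le> i" and "i < j" and "j \<le> n + 3"
proof -
  have "i < j" "{i, j} \<in> polygon_sides n \<or> {i, j} \<in> diagonals n"
    using assms unfolding edge_def noncrossing_sets_def by auto
  then show "1 \<le> i" and "i < j" and "j \<le> n + 3"
    using polygon_sides_iff[of i j n] diagonals_iff[of i j n] by auto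
qed

text \<open>A side takes part in no interleaving: consecutive vertices have nothing between them,
  and nothing lies beyond \<open>1\<close> and \<open>n + 3\<close>. So both edges would be
  diagonals of \<open>T\<close>. The other interleaving follows by exchanging the two edges.\<close>

lemma edge_noncrossing:
  assumes T: "T \<in> noncrossing_sets n" and ij: "edge n T i j" and kl: "edge n T k l"
  shows "\<not> (i < k \<and> k < j \<and> j < l)"
proof
  assume cr: "i < k \<and> k < j \<and> j < l"
  have "1 \<le> i" "l \<le> n + 3"
    using edge_bounds[OF T] ij kl by auto
  then have "{i, j} \<notin> polygon_sides n" "{k, l} \<notin> polygon_sides n"
    using cr polygon_sides_iff[of i j n] polygon_sides_iff[of k l n] by auto
  then have "{i, j} \<in> T" "{k, l} \<in> T"
    using ij kl by (auto simp: edge_def)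
  moreover have "crossing {i, j} {k, l}"
    using cr crossing_iff[of i j k l] by auto
  ultimately show False
    using T unfolding noncrossing_sets_def by blast
qed

lemma edge_side: "1 \<le> i \<Longrightarrow> i \<le> n + 2 \<Longrightarrow> edge n T i (i + 1)"
  using polygon_sides_iff[of i "i + 1" n] by (auto simp: edge_def)

lemma edge_base: "edge n T 1 (n + 3)"
  using polygon_sides_iff[of 1 "n + 3" n] by (auto simp: edge_def)

lemma edge_cases:
  assumes "T \<in> noncrossing_sets n" and "edge n T i j"
  obtains "j = i + 1" | "i = 1" "j = n + 3" | "{i, j} \<in> T"
  using assms polygon_sides_iff[of i j n] unfolding edge_def by auto

lemma noncrossing_insert:
  assumes D: "D \<in> noncrossing_sets n" and ij: "i < j" "{i, j} \<in> diagonals n"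
    and nc: "\<And>k l. k < l \<Longrightarrow> {k, l} \<in> D \<Longrightarrow>
      \<not> (i < k \<and> k < j \<and> j < l) \<and> \<not> (k < i \<and> i < l \<and> l < j)"
  shows "insert {i, j} D \<in> noncrossing_sets n"
proof -
  have 1: "\<not> crossing {i, j} e" if "e \<in> D" for e
  proof -
    have "e \<in> diagonals n"
      using that D unfolding noncrossing_sets_def by blast
    then obtain k l where "e = {k, l}" "k < l"
      by (rule diagonalsE)
    then show ?thesis
      using nc[of k l] that crossing_iff[of i j k l] ij by auto
  qed
  moreover have "\<not> crossing {i, j} {i, j}"
    using crossing_iff[of i j i j] ij by auto
  ultimately show ?thesis
    using D ij crossing_sym unfolding noncrossing_sets_def by (auto; blast)
qed

text \<open>Unless the segment is a side, it can be inserted into \<open>T\<close> without a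
  crossing, so maximality puts it into \<open>T\<close> already. This is how the missing side of a
  triangle is found.\<close>

lemma edge_maximal:
  assumes T: "T \<in> triangulations n" and "1 \<le> i" "i < j" "j \<le> n + 3"
    and nc: "\<And>k l. edge n T k l \<Longrightarrow>
      \<not> (i < k \<and> k < j \<and> j < l) \<and> \<not> (k < i \<and> i < l \<and> l < j)"
  shows "edge n T i j"
proof (cases "{i, j} \<in> polygon_sides n")
  case True
  then show ?thesis using assms by (simp add: edge_def)
next
  case False
  then have "{i, j} \<in> diagonals n"
    using assms polygon_sides_iff[of i j n] diagonals_iff[of i j n] by auto
  then have "insert {i, j} T \<in> noncrossing_sets n"
    using noncrossing_insert[OF triangulation_noncrossing[OF T] \<open>i < j\<close>] nc
    by (auto simp: edge_def)
  then have "insert {i, j} T = T"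
    using triangulation_maximal[OF T] by blast
  then show ?thesis
    using assms by (auto simp: edge_def)
qed

text \<open>The farthest neighbour \<open>k < j\<close> of \<open>i\<close> works: a diagonal crossing \<open>{k, j}\<close> would cross
  \<open>{i, k}\<close> or \<open>{i, j}\<close>, or join \<open>i\<close> to a vertex beyond \<open>k\<close>.\<close>

lemma inner_apex:
  assumes T: "T \<in> triangulations n" and ij: "edge n T i j" and "i + 2 \<le> j"
  obtains k where "i < k" "k < j" "edge n T i k" "edge n T k j"
proof -
  note nc = edge_noncrossing[OF triangulation_noncrossing[OF T]]
  note bd = edge_bounds[OF triangulation_noncrossing[OF T]]
  define A where "A = {k. k < j \<and> edge n T i k}"
  define k where "k = Max A"
  have fin: "finite A"
    unfolding A_def by simp
  have "i + 1 \<in> A"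
    using edge_side[of i n T] bd[OF ij] assms unfolding A_def by auto
  then have "k \<in> A"
    unfolding k_def using fin Max_in by blast
  then have k: "k < j" "edge n T i k"
    unfolding A_def by auto
  have ik: "i < k"
    using k by (auto simp: edge_def)
  have max: "q \<le> k" if "q < j" "edge n T i q" for q
    using that fin unfolding k_def A_def by auto
  have "edge n T k j"
  proof (rule edge_maximal[OF T])
    fix p q assume pq: "edge n T p q"
    have "\<not> (k < p \<and> p < j \<and> j < q)"
      using nc[OF ij pq] ik by auto
    moreover have False if "p < k" "k < q" "q < j"
    proof -
      have "p \<le> i"
        using nc[OF k(2) pq] that by auto
      moreover have "\<not> p < i"
        using nc[OF pq ij] that ik by auto
      ultimately have "p = i" by simp
      then show False
        using max[of q] pq that by auto
    qed
    ultimately show "\<not> (k < p \<and> p < j \<and> j < q) \<and> \<not> (p < k \<and> k < q \<and> q < j)"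
      by blast
  qed (use bd[OF ij] ik k in auto)
  then show ?thesis
    using that ik k by blast
qed

text \<open>Among the edges other than \<open>{i, j}\<close> that span it, take a shortest one,
  \<open>{p, q}\<close>; the base shows that there is one. Its inner apex cuts off a shorter edge
  that still spans \<open>{i, j}\<close>, which by minimality is \<open>{i, j}\<close> itself. So
  \<open>p\<close> or \<open>q\<close> is the apex sought.\<close>

lemma outer_apex:
  assumes T: "T \<in> triangulations n" and ij: "edge n T i j" and nb: "\<not> (i = 1 \<and> j = n + 3)"
  obtains (left) m where "m < i" "edge n T m i" "edge n T m j"
    | (right) m where "j < m" "edge n T i m" "edge n T j m"
proof -
  note nc = edge_noncrossing[OF triangulation_noncrossing[OF T]]
  note bd = edge_bounds[OF triangulation_noncrossing[OF T]]
  define P where "P = (\<lambda>(p, q). edge n T p q \<and> p \<le> i \<and> j \<le> q \<and> (p, q) \<noteq> (i, j))"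
  have "P (1, n + 3)"
    using edge_base[of n T] bd[OF ij] nb unfolding P_def by auto
  then obtain x where x: "P x" "\<And>y. P y \<Longrightarrow> snd x - fst x \<le> snd y - fst y"
    using exists_least_iff[of "\<lambda>w. \<exists>x. P x \<and> snd x - fst x = w"] by (metis not_le)
  obtain p q where pq: "x = (p, q)" by (cases x)
  have e: "edge n T p q" "p \<le> i" "j \<le> q" "(p, q) \<noteq> (i, j)"
    using x(1) unfolding P_def pq by auto
  have ij': "i < j" using bd[OF ij] by auto
  have "p + 2 \<le> q" using e ij' by auto
  from inner_apex[OF T e(1) this] obtain k where k: "p < k" "k < q" "edge n T p k" "edge n T k q"
    by blast
  \<comment> \<open>Here \<open>p < i\<close> or \<open>j < q\<close>. An apex strictly between
    \<open>i\<close> and \<open>j\<close> would make \<open>{p, k}\<close> cross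
    \<open>{i, j}\<close> in the first case and \<open>{k, q}\<close> in the second.\<close>
  have "k \<le> i \<or> j \<le> k"
    using nc[OF k(3) ij] nc[OF ij k(4)] e k ij' by (auto simp: not_le)
  then show ?thesis
  proof
    assume "k \<le> i"
    then have "\<not> P (k, q)"
      using x(2)[of "(k, q)"] k unfolding pq by fastforce
    then have "k = i" "q = j"
      using k e \<open>k \<le> i\<close> unfolding P_def by auto
    then show ?thesis
      using left[of p] k e by auto
  next
    assume "j \<le> k"
    then have "\<not> P (p, k)"
      using x(2)[of "(p, k)"] k unfolding pq by fastforce
    then have "p = i" "k = j"
      using k e \<open>j \<le> k\<close> unfolding P_def by auto
    then show ?thesis
      using right[of q] k e by auto
  qed
qed

text \<open>Every vertex strictly between \<open>1\<close> and \<open>n + 3\<close> is the inner apex of exactly one edge that is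
  a diagonal or the base \<open>{1, n + 3}\<close>.\<close>

lemma card_triangulation:
  assumes T: "T \<in> triangulations n"
  shows "card T = n"
proof -
  note nc = edge_noncrossing[OF triangulation_noncrossing[OF T]]
  note bd = edge_bounds[OF triangulation_noncrossing[OF T]]
  \<comment> \<open>\<open>L\<close> lists the diagonals of \<open>T\<close> and the base; the sides
    joining consecutive vertices drop out.\<close>
  define L where "L = {(i, j). edge n T i j \<and> i + 2 \<le> j}"
  define ap where "ap = (\<lambda>(i, j) k. i < k \<and> k < j \<and> edge n T i k \<and> edge n T k j)"
  define f where "f x = (SOME k. ap x k)" for x
  have f: "ap x (f x)" if "x \<in> L" for x
  proof -
    obtain i j where x: "x = (i, j)" by (cases x)
    with that have "edge n T i j" "i + 2 \<le> j" unfolding L_def by auto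
    from inner_apex[OF T this] have "\<exists>k. ap x k"
      unfolding x ap_def by auto
    then show ?thesis unfolding f_def by (rule someI_ex)
  qed
  have uniq: "k = k'" if "x \<in> L" "ap x k" "ap x k'" for x k k'
  proof -
    have *: "\<not> k < k'" if "ap x k" "ap x k'" for k k'
      using that nc[of "fst x" k' k "snd x"] unfolding ap_def by (cases x) auto
    show ?thesis
      using *[of k k'] *[of k' k] that by auto
  qed
  have "bij_betw f L {2..n + 2}"
  proof (rule bij_betw_imageI)
    show "inj_on f L"
    proof (rule inj_onI)
      fix x y assume xy: "x \<in> L" "y \<in> L" "f x = f y"
      obtain i j where x: "x = (i, j)" by (cases x)
      obtain i' j' where y: "y = (i', j')" by (cases y)
      obtain k where k: "ap (i, j) k" "ap (i', j') k"
        using f[OF xy(1)] f[OF xy(2)] xy(3) x y by auto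
      have e: "edge n T i j" "edge n T i' j'"
        using xy x y unfolding L_def by auto
      have a: "i < k" "k < j" "i' < k" "k < j'" "edge n T i k" "edge n T k j"
         "edge n T i' k" "edge n T k j'"
        using k unfolding ap_def by auto
      \<comment> \<open>Two edges with the same apex \<open>k\<close> both span \<open>k\<close>.
        If, say, \<open>i < i'\<close>, then \<open>{i, k}\<close> would cross
        \<open>{i', j'}\<close>.\<close>
      have "i = i'"
        using nc[OF a(5) e(2)] nc[OF a(7) e(1)] a by linarith
      moreover have "j = j'"
        using nc[OF e(1) a(8)] nc[OF e(2) a(6)] a by linarith
      ultimately show "x = y" using x y by simp
    qed
    show "f ` L = {2..n + 2}"
    proof
      show "f ` L \<subseteq> {2..n + 2}"
      proof
        fix k assume "k \<in> f ` L"
        then obtain x where x: "x \<in> L" "k = f x" by blast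
        then show "k \<in> {2..n + 2}"
          using f[OF x(1)] bd unfolding ap_def by (cases x) fastforce
      qed
      show "{2..n + 2} \<subseteq> f ` L"
      proof
        fix k assume k: "k \<in> {2..n + 2}"
        \<comment> \<open>The edge with apex \<open>k\<close> is a shortest one spanning
          \<open>k\<close>: any other apex would cut off a shorter edge that still spans
          \<open>k\<close>.\<close>
        define P where "P = (\<lambda>(i, j). edge n T i j \<and> i < k \<and> k < j)"
        have "P (1, n + 3)"
          using edge_base[of n T] k unfolding P_def by auto
        then obtain x where x: "P x" "\<And>y. P y \<Longrightarrow> snd x - fst x \<le> snd y - fst y"
          using exists_least_iff[of "\<lambda>w. \<exists>x. P x \<and> snd x - fst x = w"] by (metis not_le)
        obtain i j where ij: "x = (i, j)" by (cases x)
        have e: "edge n T i j" "i < k" "k < j"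
          using x(1) unfolding P_def ij by auto
        then have L: "x \<in> L" unfolding L_def ij by auto
        have a: "i < f x" "f x < j" "edge n T i (f x)" "edge n T (f x) j"
          using f[OF L] unfolding ij ap_def by auto
        have "\<not> P (i, f x)" "\<not> P (f x, j)"
          using x(2)[of "(i, f x)"] x(2)[of "(f x, j)"] a ij by auto
        then have "f x = k"
          using a e unfolding P_def by auto
        then show "k \<in> f ` L" using L by blast
      qed
    qed
  qed
  \<comment> \<open>The surplus of one over \<open>n\<close> is the base, which belongs to
    \<open>L\<close> but is no diagonal.\<close>
  then have "card L = n + 1"
    using bij_betw_same_card by fastforce
  moreover have "bij_betw (\<lambda>(i, j). {i, j}) L (insert {1, n + 3} T)"
  proof (rule bij_betw_imageI)
    show "inj_on (\<lambda>(i, j). {i, j}) L"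
      by (auto simp: inj_on_def L_def doubleton_eq_iff)
    show "(\<lambda>(i, j). {i, j}) ` L = insert {1, n + 3} T"
    proof
      show "(\<lambda>(i, j). {i, j}) ` L \<subseteq> insert {1, n + 3} T"
        using edge_cases[OF triangulation_noncrossing[OF T]] unfolding L_def by fastforce
      have "(1, n + 3) \<in> L"
        using edge_base[of n T] unfolding L_def by auto
      moreover have "d \<in> (\<lambda>(i, j). {i, j}) ` L" if "d \<in> T" for d
      proof -
        have d: "d \<in> diagonals n"
          using that triangulation_noncrossing[OF T] unfolding noncrossing_sets_def by blast
        then obtain i j where "d = {i, j}" "i < j" by (rule diagonalsE)
        then have "(i, j) \<in> L"
          using d that diagonals_iff[of i j n] unfolding L_def edge_def by auto
        then show ?thesis using \<open>d = {i, j}\<close> by force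
      qed
      ultimately show "insert {1, n + 3} T \<subseteq> (\<lambda>(i, j). {i, j}) ` L"
        by force
    qed
  qed
  then have "card L = card (insert {1, n + 3} T)"
    by (rule bij_betw_same_card)
  moreover have "{1, n + 3} \<notin> T"
    using triangulation_noncrossing[OF T] diagonals_iff[of 1 "n + 3" n]
    unfolding noncrossing_sets_def by auto
  ultimately show ?thesis
    using finite_noncrossing[OF triangulation_noncrossing[OF T]] by simp
qed

text \<open>Any triangulation extending \<open>D\<close> has no more elements than \<open>D\<close>.
  Thus maximality after a flip can be checked by counting.\<close>

lemma triangulation_if_card:
  assumes "D \<in> noncrossing_sets n" and "card D = n"
  shows "D \<in> triangulations n"
proof -
  obtain T where T: "T \<in> triangulations n" "D \<subseteq> T"
    using noncrossing_extends[OF assms(1)] by blast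
  then have "D = T"
    using card_triangulation[OF T(1)] assms(2)
      finite_noncrossing[OF triangulation_noncrossing[OF T(1)]] card_subset_eq by metis
  then show ?thesis using T by simp
qed

section \<open>Flips\<close>

lemma flips_toI:
  assumes "\<Delta> \<in> triangles n T" "\<Delta>' \<in> triangles n T" "\<Delta> \<noteq> \<Delta>'" "d \<in> T"
    "d = \<Delta> \<inter> \<Delta>'" "d' = (\<Delta> \<union> \<Delta>') - d"
  shows "flips_to n T d d'"
  unfolding flips_to_def using assms by (intro conjI bexI)

text \<open>A segment that crosses one diagonal of the quadrilateral \<open>a < b < c < e\<close>
  but none of its four sides is the other diagonal. So once \<open>d\<close> is removed,
  \<open>d'\<close> fits in, and the number of diagonals is again \<open>n\<close>. The disjunction
  covers flips in both directions.\<close>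

lemma quadrilateral_flip:
  assumes T: "T \<in> triangulations n" and "d \<in> T"
    and e: "edge n T a b" "edge n T b c" "edge n T c e" "edge n T a e"
    and dd: "d = {a, c} \<and> d' = {b, e} \<or> d = {b, e} \<and> d' = {a, c}"
  shows "flips_to n T d d'" and "d' \<notin> T" and "insert d' (T - {d}) \<in> triangulations n"
proof -
  note Tn = triangulation_noncrossing[OF T]
  note nc = edge_noncrossing[OF Tn]
  note bd = edge_bounds[OF Tn]
  have o: "1 \<le> a" "a < b" "b < c" "c < e" "e \<le> n + 3"
    using bd[OF e(1)] bd[OF e(2)] bd[OF e(3)] by auto
  show d': "d' \<notin> T"
    using dd \<open>d \<in> T\<close> nc[of a c b e] o unfolding edge_def by auto
  have tri: "{x, y, z} \<in> triangles n T"
    if "edge n T x y" "edge n T y z" "edge n T x z" for x y z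
    using that bd[OF that(1)] bd[OF that(2)] unfolding triangles_def edge_def polygon_vertices_def
    by (auto simp: insert_commute)
  show "flips_to n T d d'"
  proof (cases "d = {a, c} \<and> d' = {b, e}")
    case True
    then have "edge n T a c" using \<open>d \<in> T\<close> o by (auto simp: edge_def)
    then have "{a, b, c} \<in> triangles n T" "{a, c, e} \<in> triangles n T"
      using tri e by auto
    moreover have "{a, b, c} \<noteq> {a, c, e}" "d = {a, b, c} \<inter> {a, c, e}"
        "d' = ({a, b, c} \<union> {a, c, e}) - d"
      using True o by auto
    ultimately show ?thesis
      using \<open>d \<in> T\<close> by (intro flips_toI)
  next
    case False
    then have False: "d = {b, e}" "d' = {a, c}" using dd by auto
    then have "edge n T b e" using \<open>d \<in> T\<close> o by (auto simp: edge_def)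
    then have "{a, b, e} \<in> triangles n T" "{b, c, e} \<in> triangles n T"
      using tri e by auto
    moreover have "{a, b, e} \<noteq> {b, c, e}" "d = {a, b, e} \<inter> {b, c, e}"
        "d' = ({a, b, e} \<union> {b, c, e}) - d"
      using False o by auto
    ultimately show ?thesis
      using \<open>d \<in> T\<close> by (intro flips_toI)
  qed
  have sub: "T - {d} \<in> noncrossing_sets n"
    using noncrossing_subset[OF Tn] by blast
  have "insert d' (T - {d}) \<in> noncrossing_sets n"
  proof (cases "d = {a, c} \<and> d' = {b, e}")
    case True
    have "{b, e} \<in> diagonals n"
      using o diagonals_iff[of b e n] by auto
    moreover have "\<not> (b < k \<and> k < e \<and> e < l) \<and> \<not> (k < b \<and> b < l \<and> l < e)"
      if "k < l" "{k, l} \<in> T - {d}" for k l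
    proof -
      have kl: "edge n T k l" "(k, l) \<noteq> (a, c)" using that True by (auto simp: edge_def)
      show ?thesis
        \<comment> \<open>A segment crossing \<open>{b, e}\<close> and no side of the quadrilateral
          would have to be \<open>{a, c}\<close>, which has been removed.\<close>
        using nc[OF e(1) kl(1)] nc[OF e(2) kl(1)] nc[OF e(3) kl(1)] nc[OF e(4) kl(1)]
          nc[OF kl(1) e(1)] nc[OF kl(1) e(2)] nc[OF kl(1) e(3)] nc[OF kl(1) e(4)] kl(2) o
        by (smt (verit) linorder_less_linear order_less_trans)
    qed
    ultimately show ?thesis
      using noncrossing_insert[OF sub, of b e] o True by auto
  next
    case False
    then have False: "d = {b, e}" "d' = {a, c}" using dd by auto
    have "{a, c} \<in> diagonals n"
      using o diagonals_iff[of a c n] by auto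
    moreover have "\<not> (a < k \<and> k < c \<and> c < l) \<and> \<not> (k < a \<and> a < l \<and> l < c)"
      if "k < l" "{k, l} \<in> T - {d}" for k l
    proof -
      have kl: "edge n T k l" "(k, l) \<noteq> (b, e)" using that False by (auto simp: edge_def)
      show ?thesis
        using nc[OF e(1) kl(1)] nc[OF e(2) kl(1)] nc[OF e(3) kl(1)] nc[OF e(4) kl(1)]
          nc[OF kl(1) e(1)] nc[OF kl(1) e(2)] nc[OF kl(1) e(3)] nc[OF kl(1) e(4)] kl(2) o
        by (smt (verit) linorder_less_linear order_less_trans)
    qed
    ultimately show ?thesis
      using noncrossing_insert[OF sub, of a c] o False by auto
  qed
  moreover have "card (insert d' (T - {d})) = n"
    using card_triangulation[OF T] d' \<open>d \<in> T\<close> finite_noncrossing[OF Tn]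
    by (simp add: card_Suc_Diff1 del: card_Diff_insert)
  ultimately show "insert d' (T - {d}) \<in> triangulations n"
    by (rule triangulation_if_card)
qed

text \<open>The apexes on the two sides of \<open>d\<close> complete it to a quadrilateral; the
  outer one exists because a diagonal is not the base. If it lies to the left, \<open>d\<close>
  plays the role of \<open>{b, e}\<close> in \<open>quadrilateral_flip\<close>, otherwise that of
  \<open>{a, c}\<close>.\<close>

lemma flip_exists:
  assumes T: "T \<in> triangulations n" and d: "d \<in> T"
  obtains d' where "flips_to n T d d'" "d' \<notin> T" "insert d' (T - {d}) \<in> triangulations n"
proof -
  have dd: "d \<in> diagonals n"
    using d triangulation_noncrossing[OF T] unfolding noncrossing_sets_def by blast
  then obtain i j where ij: "d = {i, j}" "i < j" by (rule diagonalsE)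
  then have e: "edge n T i j" and "i + 2 \<le> j" and nb: "\<not> (i = 1 \<and> j = n + 3)"
    using d dd diagonals_iff[of i j n] by (auto simp: edge_def)
  from inner_apex[OF T e this(2)] obtain k where k: "i < k" "k < j" "edge n T i k" "edge n T k j"
    by blast
  from T e nb show ?thesis
  proof (cases rule: outer_apex)
    case (left m)
    show ?thesis
      using quadrilateral_flip[OF T d left(2) k(3,4) left(3), of "{m, k}"] ij that by blast
  next
    case (right m)
    show ?thesis
      using quadrilateral_flip[OF T d k(3,4) right(3,2), of "{k, m}"] ij that by blast
  qed
qed

text \<open>Since \<open>flips_to\<close> hands over two triangles and no ordered quadrilateral, the
  argument uses the triangles directly: from \<open>{p, q, r}\<close> and \<open>{p, q, s}\<close>
  one passes to \<open>{r, s, p}\<close> and \<open>{r, s, q}\<close>.\<close>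

lemma flips_to_sym:
  assumes T: "T \<subseteq> diagonals n" and f: "flips_to n T d d'"
  shows "d \<noteq> d'" and "flips_to n (insert d' (T - {d})) d' d"
proof -
  obtain \<Delta> \<Delta>' where tri: "\<Delta> \<in> triangles n T" "\<Delta>' \<in> triangles n T" "\<Delta> \<noteq> \<Delta>'"
    and d: "d \<in> T" "d = \<Delta> \<inter> \<Delta>'" "d' = (\<Delta> \<union> \<Delta>') - d"
    using f unfolding flips_to_def by blast
  obtain p q where pq: "d = {p, q}" "p < q"
    using d(1) T diagonalsE[of d n] by blast
  have third: "\<exists>r. r \<notin> {p, q} \<and> X = {p, q, r}" if "X \<in> triangles n T" "d \<subseteq> X" for X
  proof -
    have "card X = 3" "finite X"
      using that card_gt_0_iff[of X] unfolding triangles_def by auto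
    then have "card (X - {p, q}) = 1"
      using that pq by (subst card_Diff_subset) auto
    then obtain r where "X - {p, q} = {r}"
      by (auto simp: card_1_singleton_iff)
    then show ?thesis
      using that pq by auto
  qed
  obtain r s where r: "r \<notin> {p, q}" "\<Delta> = {p, q, r}" and s: "s \<notin> {p, q}" "\<Delta>' = {p, q, s}"
    using third tri d(2) by (metis inf_le1 inf_le2)
  have rs: "r \<noteq> s" using tri r s by auto
  have d': "d' = {r, s}" using d(3) r s pq by auto
  show "d \<noteq> d'" using pq d' r by auto
  let ?T = "insert d' (T - {d})"
  have e: "{x, y} \<in> polygon_sides n \<union> ?T"
    if "X \<in> triangles n T" "x \<in> X" "y \<in> X" "x \<noteq> y" "{x, y} \<noteq> d" for X x y
    using that unfolding triangles_def by blast
  \<comment> \<open>The four outer segments differ from \<open>d\<close>, the only one that is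
    removed, and therefore survive.\<close>
  have sides: "{r, p} \<in> polygon_sides n \<union> ?T" "{r, q} \<in> polygon_sides n \<union> ?T"
    "{s, p} \<in> polygon_sides n \<union> ?T" "{s, q} \<in> polygon_sides n \<union> ?T"
    using e[OF tri(1)] e[OF tri(2)] r s pq by (auto simp: doubleton_eq_iff)
  have "\<Delta> \<union> \<Delta>' \<subseteq> polygon_vertices n"
    using tri unfolding triangles_def by blast
  then have "{r, s, p} \<in> triangles n ?T" "{r, s, q} \<in> triangles n ?T"
    unfolding triangles_def using sides rs r s pq d' by (auto simp: insert_commute)
  moreover have "{r, s, p} \<noteq> {r, s, q}" "d' = {r, s, p} \<inter> {r, s, q}"
    "d = {r, s, p} \<union> {r, s, q} - d'"
    using rs r s pq d' by auto
  ultimately show "flips_to n ?T d' d"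
    by (intro flips_toI) (assumption | rule insertI1)+
qed

section \<open>Connectedness of the flip graph above a given set of diagonals\<close>

definition flip_steps :: "nat \<Rightarrow> nat set set \<Rightarrow> nat set set rel"
  where "flip_steps n D = {(T, T'). T \<in> triangulations n \<and> T' \<in> triangulations n \<and>
    (\<exists>d\<in>T - D. \<exists>d'. d' \<notin> T \<and> flips_to n T d d' \<and> T' = insert d' (T - {d}))}"

lemma flip_steps_supset: "(T, T') \<in> flip_steps n D \<Longrightarrow> D \<subseteq> T \<Longrightarrow> D \<subseteq> T'"
  unfolding flip_steps_def by blast

text \<open>The condition \<open>d' \<notin> T\<close> in \<open>flip_steps\<close> has two effects:
  \<open>T\<close> is recovered by trading \<open>d'\<close> for \<open>d\<close>, and
  \<open>d'\<close> lies outside \<open>D\<close> because \<open>D \<subseteq> T\<close>, so that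
  flipping it back is allowed.\<close>

lemma flip_steps_sym:
  assumes "(T, T') \<in> flip_steps n D" and "D \<subseteq> T"
  shows "(T', T) \<in> flip_steps n D"
proof -
  obtain d d' where T: "T \<in> triangulations n" "T' \<in> triangulations n"
    and d: "d \<in> T - D" "d' \<notin> T" "flips_to n T d d'" "T' = insert d' (T - {d})"
    using assms unfolding flip_steps_def by blast
  have "T \<subseteq> diagonals n"
    using triangulation_noncrossing[OF T(1)] unfolding noncrossing_sets_def by blast
  from flips_to_sym[OF this d(3)] have "d \<noteq> d'" "flips_to n T' d' d"
    unfolding d(4) by auto
  moreover have "T = insert d (T' - {d'})" "d \<notin> T'" "d' \<in> T' - D"
    using d assms(2) \<open>d \<noteq> d'\<close> by auto
  ultimately show ?thesis
    unfolding flip_steps_def using T by blast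
qed

text \<open>A flip is decreasing if it replaces \<open>{b, e}\<close> by \<open>{a, c}\<close> in a quadrilateral \<open>a < b < c < e\<close>,
  which lowers the sum of all end points. Terminal means: no decreasing flip outside of \<open>D\<close>.\<close>

definition terminal :: "nat \<Rightarrow> nat set set \<Rightarrow> nat set set \<Rightarrow> bool"
  where "terminal n D T \<longleftrightarrow>
    (\<forall>m i j. edge n T m i \<and> edge n T m j \<and> i < j \<and> {i, j} \<in> T \<longrightarrow> {i, j} \<in> D)"

text \<open>Where \<open>terminal\<close> fails, the common neighbour \<open>m\<close> and the inner
  apex \<open>k\<close> of \<open>{i, j}\<close> span a quadrilateral \<open>m < i < k < j\<close>.
  Replacing \<open>{i, j}\<close> by \<open>{m, k}\<close> lowers the induction measure, and
  \<open>D\<close> is kept because \<open>{i, j} \<notin> D\<close>.\<close>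

lemma reaches_terminal:
  assumes "T \<in> triangulations n" and "D \<subseteq> T"
  shows "\<exists>T'. (T, T') \<in> (flip_steps n D)\<^sup>* \<and> T' \<in> triangulations n \<and> D \<subseteq> T' \<and> terminal n D T'"
  using assms
proof (induction "\<Sum>d\<in>T. \<Sum>d" arbitrary: T rule: less_induct)
  case less
  note T = less.prems(1)
  note bd = edge_bounds[OF triangulation_noncrossing[OF T]]
  show ?case
  proof (cases "terminal n D T")
    case True
    then show ?thesis using less.prems by blast
  next
    case False
    then obtain m i j where mij: "edge n T m i" "edge n T m j" "i < j" "{i, j} \<in> T" "{i, j} \<notin> D"
      unfolding terminal_def by blast
    have "{i, j} \<in> diagonals n"
      using mij triangulation_noncrossing[OF T] unfolding noncrossing_sets_def by blast
    then have "edge n T i j" "i + 2 \<le> j"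
      using mij diagonals_iff[of i j n] by (auto simp: edge_def)
    from inner_apex[OF T this] obtain k where k: "i < k" "k < j" "edge n T i k" "edge n T k j"
      by blast
    let ?T = "insert {m, k} (T - {{i, j}})"
    note q = quadrilateral_flip[OF T mij(4) mij(1) k(3,4) mij(2), of "{m, k}"]
    have step: "(T, ?T) \<in> flip_steps n D"
      unfolding flip_steps_def using q T mij by blast
    have "m < i" using bd[OF mij(1)] by simp
    have fin: "finite T"
      using finite_noncrossing[OF triangulation_noncrossing[OF T]] .
    have "(\<Sum>d\<in>?T. \<Sum>d) = m + k + (\<Sum>d\<in>T - {{i, j}}. \<Sum>d)"
      using q fin \<open>m < i\<close> k by simp
    moreover have "(\<Sum>d\<in>T. \<Sum>d) = i + j + (\<Sum>d\<in>T - {{i, j}}. \<Sum>d)"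
      using fin mij by (subst sum.remove[of T "{i, j}"]) auto
    ultimately have "(\<Sum>d\<in>?T. \<Sum>d) < (\<Sum>d\<in>T. \<Sum>d)"
      using \<open>m < i\<close> k by linarith
    from less.hyps[OF this] obtain T' where "(?T, T') \<in> (flip_steps n D)\<^sup>*"
      "T' \<in> triangulations n" "D \<subseteq> T'" "terminal n D T'"
      using q flip_steps_supset[OF step less.prems(2)] by blast
    then show ?thesis
      using step by (meson converse_rtrancl_into_rtrancl)
  qed
qed

text \<open>The induction proceeds from long to short edges. If the outer apex of
  \<open>{i, j}\<close> lies to the left, terminality puts the diagonal \<open>{i, j}\<close> into
  \<open>D\<close>. If it is \<open>m\<close> on the right, the longer edge \<open>{i, m}\<close>
  belongs to \<open>T'\<close> by induction, and its inner apex in \<open>T'\<close> is shown to be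
  \<open>j\<close>.\<close>

lemma terminal_edge:
  assumes T: "T \<in> triangulations n" "D \<subseteq> T" "terminal n D T"
    and T': "T' \<in> triangulations n" "D \<subseteq> T'" "terminal n D T'"
    and ij: "edge n T i j"
  shows "edge n T' i j"
  using ij
proof (induction "n + 3 - (j - i)" arbitrary: i j rule: less_induct)
  case less
  note nc = edge_noncrossing[OF triangulation_noncrossing[OF T(1)]]
  note nc' = edge_noncrossing[OF triangulation_noncrossing[OF T'(1)]]
  note bd = edge_bounds[OF triangulation_noncrossing[OF T(1)]]
  \<comment> \<open>Terminality leaves two options for \<open>{p, m}\<close>: a side or an element
    of \<open>D\<close>. Both are edges of every triangulation containing \<open>D\<close>.\<close>
  have transfer: "edge n S' p m"
    if "terminal n D S" "D \<subseteq> S'" "edge n S i p" "edge n S i m" "edge n S p m" for S S' i p m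
    using that unfolding terminal_def edge_def by blast
  have ij: "i < j" using bd[OF less.prems] by simp
  show ?case
  proof (cases "{i, j} \<in> polygon_sides n")
    case True
    then show ?thesis using less.prems by (simp add: edge_def)
  next
    case False
    then have nb: "\<not> (i = 1 \<and> j = n + 3)"
      using edge_base[of n "{}"] by (auto simp: edge_def)
    from T(1) less.prems nb show ?thesis
    proof (cases rule: outer_apex)
      case (left m)
      then show ?thesis using transfer T T' less.prems by blast
    next
      case (right m)
      have "edge n T' i m"
        using less.hyps[OF _ right(2)] right(1) bd[OF right(2)] ij by auto
      moreover have "i + 2 \<le> m" using right ij by simp
      ultimately obtain k where k: "i < k" "k < m" "edge n T' i k" "edge n T' k m"
        using inner_apex[OF T'(1)] by blast
      have "edge n T k m"
        using transfer T T' k \<open>edge n T' i m\<close> by blast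
      moreover have "edge n T' j m"
        using transfer T T' right less.prems by blast
      \<comment> \<open>If \<open>k < j\<close>, then \<open>{i, j}\<close> and
        \<open>{k, m}\<close> cross in \<open>T\<close>; if \<open>j < k\<close>, then
        \<open>{i, k}\<close> and \<open>{j, m}\<close> cross in \<open>T'\<close>.\<close>
      ultimately have "k = j"
        using nc[OF less.prems, of k m] nc'[OF k(3), of j m] k right ij by linarith
      then show ?thesis using k by simp
    qed
  qed
qed

lemma terminal_unique:
  assumes T: "T \<in> triangulations n" "D \<subseteq> T" "terminal n D T"
    and T': "T' \<in> triangulations n" "D \<subseteq> T'" "terminal n D T'"
  shows "T = T'"
proof -
  have "T \<subseteq> T'"
  proof
    fix d assume d: "d \<in> T"
    then have dd: "d \<in> diagonals n"
      using triangulation_noncrossing[OF T(1)] unfolding noncrossing_sets_def by blast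
    then obtain i j where ij: "d = {i, j}" "i < j" by (rule diagonalsE)
    then have "edge n T' i j"
      using terminal_edge[OF T T', of i j] d by (simp add: edge_def)
    then show "d \<in> T'"
      using dd ij unfolding edge_def diagonals_def by auto
  qed
  then show ?thesis
    using triangulation_maximal[OF T(1) triangulation_noncrossing[OF T'(1)]] by simp
qed

lemma flip_steps_rtrancl_sym:
  assumes "(T, T') \<in> (flip_steps n D)\<^sup>*" and "D \<subseteq> T"
  shows "(T', T) \<in> (flip_steps n D)\<^sup>* \<and> D \<subseteq> T'"
  using assms(1)
proof induction
  case (step S S')
  then show ?case
    using flip_steps_sym flip_steps_supset by (meson converse_rtrancl_into_rtrancl)
qed (use assms in auto)

lemma flip_connected:
  assumes "T \<in> triangulations n" "D \<subseteq> T" "T' \<in> triangulations n" "D \<subseteq> T'"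
  shows "(T, T') \<in> (flip_steps n D)\<^sup>*"
proof -
  obtain S where S: "(T, S) \<in> (flip_steps n D)\<^sup>*" "S \<in> triangulations n" "D \<subseteq> S" "terminal n D S"
    using reaches_terminal[OF assms(1,2)] by blast
  obtain S' where S': "(T', S') \<in> (flip_steps n D)\<^sup>*" "S' \<in> triangulations n" "D \<subseteq> S'"
    "terminal n D S'"
    using reaches_terminal[OF assms(3,4)] by blast
  have "S = S'" using terminal_unique S S' by blast
  then show ?thesis
    using S(1) flip_steps_rtrancl_sym[OF S'(1) assms(4)] by (metis rtrancl_trans)
qed

text \<open>A diagonal of \<open>D'\<close> outside of \<open>D\<close> could be flipped away in a
  triangulation containing \<open>D\<close>, giving a triangulation that contains \<open>D\<close>
  but not \<open>D'\<close>. Hence a face determines its diagonals.\<close>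

lemma triangulations_supset_mono:
  assumes D: "D \<in> noncrossing_sets n"
    and sub: "{T \<in> triangulations n. D \<subseteq> T} \<subseteq> {T \<in> triangulations n. D' \<subseteq> T}"
  shows "D' \<subseteq> D"
proof
  fix d assume d: "d \<in> D'"
  obtain T where T: "T \<in> triangulations n" "D \<subseteq> T"
    using noncrossing_extends[OF D] by blast
  then have "d \<in> T" using sub d by blast
  with T(1) obtain d' where d': "flips_to n T d d'" "d' \<notin> T" "insert d' (T - {d}) \<in> triangulations n"
    by (rule flip_exists)
  show "d \<in> D"
  proof (rule ccontr)
    assume "d \<notin> D"
    then have "D \<subseteq> insert d' (T - {d})" using T by blast
    then have "d \<in> insert d' (T - {d})" using sub d d'(3) by blast
    then show False using d'(2) \<open>d \<in> T\<close> by auto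
  qed
qed

section \<open>Colorings\<close>

definition fixed_diagonals :: "'c coloring \<Rightarrow> 'c set \<Rightarrow> nat set set"
  where "fixed_diagonals t C = {d. \<exists>c. t d = Some c \<and> c \<notin> C}"

lemma fixed_diagonals_subset: "fixed_diagonals t C \<subseteq> dom t"
  unfolding fixed_diagonals_def by blast

lemma colored_triangulations_dom: "t \<in> colored_triangulations n K \<Longrightarrow> dom t \<in> triangulations n"
  unfolding colored_triangulations_def by blast

lemma coloring_inj:
  "t \<in> colored_triangulations n K \<Longrightarrow> t d = Some c \<Longrightarrow> t d' = Some c \<Longrightarrow> d = d'"
  unfolding colored_triangulations_def by (metis (mono_tags) domI inj_onD mem_Collect_eq)

lemma fixed_diagonals_noncrossing:
  "t \<in> colored_triangulations n K \<Longrightarrow> fixed_diagonals t C \<in> noncrossing_sets n"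
  by (rule noncrossing_subset[OF triangulation_noncrossing fixed_diagonals_subset])
    (rule colored_triangulations_dom)

text \<open>That \<open>d'\<close> is new follows from \<open>dom t'\<close> being a triangulation:
  otherwise \<open>dom t'\<close> would be a proper subset of \<open>dom t\<close>, against its
  maximality.\<close>

lemma colored_flipsE:
  assumes "(t, t') \<in> colored_flips n K C"
  obtains c d d' where "t \<in> colored_triangulations n K" "t' \<in> colored_triangulations n K"
    "c \<in> C" "t d = Some c" "flips_to n (dom t) d d'" "t d' = None" "d \<noteq> d'"
    "t' = t(d := None, d' := Some c)"
proof -
  obtain c d d' where t: "t \<in> colored_triangulations n K" "t' \<in> colored_triangulations n K"
    and d: "c \<in> C" "t d = Some c" "flips_to n (dom t) d d'" "t' = t(d := None, d' := Some c)"
    using assms unfolding colored_flips_def by blast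
  note T = colored_triangulations_dom[OF t(1)] colored_triangulations_dom[OF t(2)]
  have "dom t \<subseteq> diagonals n"
    using triangulation_noncrossing[OF T(1)] unfolding noncrossing_sets_def by blast
  then have "d \<noteq> d'"
    using flips_to_sym(1) d(3) by blast
  moreover have "t d' = None"
  proof (rule ccontr)
    assume "t d' \<noteq> None"
    then have "dom t' \<subseteq> dom t" "d \<in> dom t - dom t'"
      using d \<open>d \<noteq> d'\<close> by auto
    then show False
      using triangulation_maximal[OF T(2) triangulation_noncrossing[OF T(1)]] by blast
  qed
  ultimately show ?thesis
    using that t d by blast
qed

lemma colored_flips_sym:
  assumes "(t, t') \<in> colored_flips n K C"
  shows "(t', t) \<in> colored_flips n K C"
proof -
  obtain c d d' where t: "t \<in> colored_triangulations n K" "t' \<in> colored_triangulations n K"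
    and d: "c \<in> C" "t d = Some c" "flips_to n (dom t) d d'" "t d' = None" "d \<noteq> d'"
      "t' = t(d := None, d' := Some c)"
    using assms by (rule colored_flipsE)
  have "dom t \<subseteq> diagonals n"
    using triangulation_noncrossing[OF colored_triangulations_dom[OF t(1)]]
    unfolding noncrossing_sets_def by blast
  then have "flips_to n (insert d' (dom t - {d})) d' d"
    using flips_to_sym(2) d(3) by blast
  moreover have "insert d' (dom t - {d}) = dom t'"
    using d by auto
  moreover have "t' d' = Some c" "t = t'(d' := None, d := Some c)"
    using d by auto
  ultimately show ?thesis
    unfolding colored_flips_def using t d(1) by auto
qed

lemma colored_flips_fixed:
  assumes "(t, t') \<in> colored_flips n K C"
  shows "fixed_diagonals t' C = fixed_diagonals t C"
  using assms by (rule colored_flipsE) (auto simp: fixed_diagonals_def)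

lemma flip_class_induct [consumes 1, case_names refl step]:
  assumes "t' \<in> flip_class n K C t" and "P t"
    and "\<And>s s'. s \<in> flip_class n K C t \<Longrightarrow> (s, s') \<in> colored_flips n K C \<Longrightarrow> P s \<Longrightarrow> P s'"
  shows "P t'"
proof -
  have "(t, t') \<in> (colored_flips n K C)\<^sup>*"
    using assms(1) unfolding flip_class_def by simp
  then show ?thesis
    by induction (use assms in \<open>auto simp: flip_class_def\<close>)
qed

lemma flip_class_refl: "t \<in> flip_class n K C t"
  unfolding flip_class_def by simp

lemma flip_class_colored:
  assumes "t' \<in> flip_class n K C t" and "t \<in> colored_triangulations n K"
  shows "t' \<in> colored_triangulations n K"
  using assms(1) by (induction rule: flip_class_induct) (use assms in \<open>auto simp: colored_flips_def\<close>)

lemma flip_class_fixed: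
  assumes "t' \<in> flip_class n K C t"
  shows "fixed_diagonals t' C = fixed_diagonals t C"
  using assms by (induction rule: flip_class_induct) (auto simp: colored_flips_fixed)

lemma flip_class_eq:
  assumes "t' \<in> flip_class n K C t"
  shows "flip_class n K C t' = flip_class n K C t"
proof -
  have "sym (colored_flips n K C)"
    by (rule symI) (rule colored_flips_sym)
  then have "(t', t) \<in> (colored_flips n K C)\<^sup>*" "(t, t') \<in> (colored_flips n K C)\<^sup>*"
    using assms sym_rtrancl unfolding flip_class_def by (auto dest: symD)
  then show ?thesis
    unfolding flip_class_def by (auto intro: rtrancl_trans)
qed

lemma flip_class_mono:
  assumes "C \<subseteq> C'"
  shows "flip_class n K C t \<subseteq> flip_class n K C' t"
proof -
  have "colored_flips n K C \<subseteq> colored_flips n K C'"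
    using assms unfolding colored_flips_def by blast
  then show ?thesis
    unfolding flip_class_def using rtrancl_mono by blast
qed

section \<open>Lifting paths of flips to colored triangulations\<close>

lemma inj_on_dom_iff: "inj_on t (dom t) \<longleftrightarrow> (\<forall>x y e. t x = Some e \<longrightarrow> t y = Some e \<longrightarrow> x = y)"
proof
  assume t: "inj_on t (dom t)"
  show "\<forall>x y e. t x = Some e \<longrightarrow> t y = Some e \<longrightarrow> x = y"
  proof (intro allI impI)
    fix x y e assume "t x = Some e" "t y = Some e"
    then show "x = y" by (metis t domI inj_onD)
  qed
next
  assume *: "\<forall>x y e. t x = Some e \<longrightarrow> t y = Some e \<longrightarrow> x = y"
  show "inj_on t (dom t)"
  proof (rule inj_onI)
    fix x y assume x: "x \<in> dom t" "t x = t y"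
    from domD[OF x(1)] obtain e where e: "t x = Some e" ..
    then have "t y = Some e" using x(2) by simp
    with e show "x = y" by (rule *[rule_format])
  qed
qed

text \<open>The color \<open>c\<close> is taken from its only carrier \<open>d\<close> before
  \<open>d'\<close> receives it.\<close>

lemma inj_on_map_move:
  assumes t: "inj_on t (dom t)" and d: "t d = Some c"
  shows "inj_on (t(d := None, d' := Some c)) (dom (t(d := None, d' := Some c)))"
  unfolding inj_on_dom_iff
proof (intro allI impI)
  let ?t = "t(d := None, d' := Some c)"
  fix x y e
  assume e: "?t x = Some e" "?t y = Some e"
  have inj: "a = b" if "t a = Some k" "t b = Some k" for a b k
    using t[unfolded inj_on_dom_iff] that by blast
  have old: "z \<noteq> d" "t z = Some k" if "?t z = Some k" "z \<noteq> d'" for z k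
    using that by (cases "z = d"; simp)+
  have new: "z = d'" if "?t z = Some c" for z
  proof (rule ccontr)
    assume "z \<noteq> d'"
    from old(1)[OF that this] inj[OF old(2)[OF that this] d] show False by (rule notE)
  qed
  show "x = y"
  proof (cases "e = c")
    case True
    then show ?thesis using new[OF e(1)[unfolded True]] new[OF e(2)[unfolded True]] by simp
  next
    case False
    then have "x \<noteq> d'" "y \<noteq> d'" using e by auto
    then show ?thesis by (intro inj[OF old(2)[OF e(1)] old(2)[OF e(2)]])
  qed
qed

lemma flip_step_lift:
  assumes t: "t \<in> colored_triangulations n K"
    and "(dom t, T') \<in> flip_steps n (fixed_diagonals t C)"
  obtains t' where "(t, t') \<in> colored_flips n K C" "dom t' = T'"
proof -
  obtain d d' where T': "T' \<in> triangulations n" "T' = insert d' (dom t - {d})"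
    and d: "d \<in> dom t - fixed_diagonals t C" "d' \<notin> dom t" "flips_to n (dom t) d d'"
    using assms unfolding flip_steps_def by blast
  \<comment> \<open>The color of \<open>d\<close> passes to \<open>d'\<close>; it lies in
    \<open>C\<close> because \<open>d\<close> is not a fixed diagonal.\<close>
  then obtain c where c: "t d = Some c" "c \<in> C"
    unfolding fixed_diagonals_def by blast
  let ?t = "t(d := None, d' := Some c)"
  have dom: "dom ?t = T'"
    using T' d by auto
  have "ran ?t \<subseteq> ran t"
    using c by (auto simp: ran_def split: if_splits)
  moreover have "inj_on ?t (dom ?t)"
    by (rule inj_on_map_move[where c = c])
      (use t c(1) in \<open>simp_all add: colored_triangulations_def\<close>)
  ultimately have t': "?t \<in> colored_triangulations n K"
    using t T'(1) unfolding colored_triangulations_def mem_Collect_eq dom by (simp add: subset_trans)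
  have "(t, ?t) \<in> colored_flips n K C"
    unfolding colored_flips_def mem_Collect_eq case_prod_conv
    by (intro conjI bexI[of _ c] exI[of _ d] exI[of _ d'] refl) (fact t t' c d)+
  then show ?thesis using dom by (rule that)
qed

lemma dom_flip_class:
  assumes t: "t \<in> colored_triangulations n K"
  shows "dom ` flip_class n K C t = {T \<in> triangulations n. fixed_diagonals t C \<subseteq> T}"
proof
  show "dom ` flip_class n K C t \<subseteq> {T \<in> triangulations n. fixed_diagonals t C \<subseteq> T}"
    using flip_class_colored[OF _ t] colored_triangulations_dom flip_class_fixed fixed_diagonals_subset
    by (metis (no_types, lifting) image_subsetI mem_Collect_eq)
next
  let ?D = "fixed_diagonals t C"
  have lift: "\<exists>t'\<in>flip_class n K C t. dom t' = T" if "(dom t, T) \<in> (flip_steps n ?D)\<^sup>*" for T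
    using that
  proof induction
    case base
    then show ?case using flip_class_refl by blast
  next
    case (step T T')
    then obtain s where s: "s \<in> flip_class n K C t" "dom s = T" by blast
    \<comment> \<open>The fixed diagonals are constant on the class, so a step allowed for
      \<open>t\<close> is allowed for the lifted \<open>s\<close> as well.\<close>
    then have "(dom s, T') \<in> flip_steps n (fixed_diagonals s C)"
      using step flip_class_fixed by metis
    then obtain s' where "(s, s') \<in> colored_flips n K C" "dom s' = T'"
      using flip_step_lift flip_class_colored[OF s(1) t] by blast
    then show ?case
      using s(1) unfolding flip_class_def by (auto intro: rtrancl_into_rtrancl)
  qed
  show "{T \<in> triangulations n. ?D \<subseteq> T} \<subseteq> dom ` flip_class n K C t"
  proof
    fix T assume "T \<in> {T \<in> triangulations n. ?D \<subseteq> T}"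
    then have "(dom t, T) \<in> (flip_steps n ?D)\<^sup>*"
      using flip_connected[OF colored_triangulations_dom[OF t] fixed_diagonals_subset] by blast
    then show "T \<in> dom ` flip_class n K C t"
      using lift by blast
  qed
qed

section \<open>Permutations of the colors acting on colorings\<close>

lemma Bij_inverse:
  assumes "\<sigma> \<in> Bij K"
  obtains \<rho> where "\<rho> \<in> Bij K" "\<And>x. x \<in> K \<Longrightarrow> \<rho> (\<sigma> x) = x" "\<And>x. x \<in> K \<Longrightarrow> \<sigma> (\<rho> x) = x"
proof
  show "restrict (inv_into K \<sigma>) K \<in> Bij K"
    using assms by (rule restrict_inv_into_Bij)
  have "bij_betw \<sigma> K K" using assms by (simp add: Bij_def)
  then show "restrict (inv_into K \<sigma>) K (\<sigma> x) = x" "\<sigma> (restrict (inv_into K \<sigma>) K x) = x"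
    if "x \<in> K" for x
    using that by (auto simp: bij_betw_inv_into_left bij_betw_inv_into_right bij_betwE)
qed

lemma dom_recolor [simp]: "dom (recolor \<sigma> t) = dom t"
  unfolding recolor_def by auto

lemma recolor_colored:
  assumes "\<sigma> \<in> Bij K" and t: "t \<in> colored_triangulations n K"
  shows "recolor \<sigma> t \<in> colored_triangulations n K"
proof -
  have \<sigma>: "inj_on \<sigma> K" "\<sigma> ` K = K"
    using assms by (auto simp: Bij_def bij_betw_def)
  have t': "ran t \<subseteq> K" "inj_on t (dom t)"
    using t by (auto simp: colored_triangulations_def)
  have "ran (recolor \<sigma> t) \<subseteq> K"
    using t' \<sigma> by (auto simp: recolor_def ran_def)
  moreover have "inj_on (recolor \<sigma> t) (dom t)"
  proof (rule inj_onI)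
    fix d d' assume d: "d \<in> dom t" "d' \<in> dom t" "recolor \<sigma> t d = recolor \<sigma> t d'"
    then obtain c c' where c: "t d = Some c" "t d' = Some c'" by blast
    then have "c \<in> K" "c' \<in> K" using t' by (auto intro: ranI)
    then have "c = c'" using \<sigma>(1) d(3) c by (auto simp: recolor_def inj_on_def)
    then show "d = d'" using t'(2) c d by (auto simp: inj_on_def)
  qed
  ultimately show ?thesis
    using t unfolding colored_triangulations_def by simp
qed

text \<open>Agreement is asked on \<open>K\<close> only, because products in
  \<open>BijGroup K\<close> are composed on \<open>K\<close> and undefined elsewhere.\<close>

lemma recolor_recolor:
  assumes "t \<in> colored_triangulations n K" and "\<And>x. x \<in> K \<Longrightarrow> \<upsilon> x = \<sigma> (\<tau> x)"
  shows "recolor \<sigma> (recolor \<tau> t) = recolor \<upsilon> t"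
proof
  fix d
  show "recolor \<sigma> (recolor \<tau> t) d = recolor \<upsilon> t d"
    using assms by (cases "t d") (auto simp: recolor_def colored_triangulations_def dest: ranI)
qed

lemma recolor_ident:
  assumes "t \<in> colored_triangulations n K" and "\<And>x. x \<in> K \<Longrightarrow> \<sigma> x = x"
  shows "recolor \<sigma> t = t"
proof
  fix d
  show "recolor \<sigma> t d = t d"
    using assms by (cases "t d") (auto simp: recolor_def colored_triangulations_def dest: ranI)
qed

lemma recolor_flip:
  assumes "\<sigma> \<in> Bij K" and "(t, t') \<in> colored_flips n K C"
  shows "(recolor \<sigma> t, recolor \<sigma> t') \<in> colored_flips n K (\<sigma> ` C)"
proof -
  obtain c d d' where t: "t \<in> colored_triangulations n K" "t' \<in> colored_triangulations n K"
    and d: "c \<in> C" "t d = Some c" "flips_to n (dom t) d d'" "t' = t(d := None, d' := Some c)"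
    using assms(2) unfolding colored_flips_def by blast
  have "recolor \<sigma> t d = Some (\<sigma> c)"
    "recolor \<sigma> t' = (recolor \<sigma> t)(d := None, d' := Some (\<sigma> c))"
    using d by (auto simp: recolor_def)
  then show ?thesis
    unfolding colored_flips_def
    using recolor_colored[OF assms(1) t(1)] recolor_colored[OF assms(1) t(2)] d
    by (auto intro!: bexI[of _ c])
qed

lemma recolor_flip_class_subset:
  assumes "\<sigma> \<in> Bij K" and "t' \<in> flip_class n K C t"
  shows "recolor \<sigma> t' \<in> flip_class n K (\<sigma> ` C) (recolor \<sigma> t)"
  using assms(2)
proof (induction rule: flip_class_induct)
  case (step s s')
  then show ?case
    using recolor_flip[OF assms(1)] unfolding flip_class_def by (auto intro: rtrancl_into_rtrancl)
qed (rule flip_class_refl)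

text \<open>Recoloring carries flip paths to flip paths; the same for the inverse permutation yields
  the converse inclusion.\<close>

lemma recolor_flip_class:
  assumes \<sigma>: "\<sigma> \<in> Bij K" and "C \<subseteq> K" and t: "t \<in> colored_triangulations n K"
  shows "recolor \<sigma> ` flip_class n K C t = flip_class n K (\<sigma> ` C) (recolor \<sigma> t)"
proof
  show "recolor \<sigma> ` flip_class n K C t \<subseteq> flip_class n K (\<sigma> ` C) (recolor \<sigma> t)"
    using recolor_flip_class_subset[OF \<sigma>] by blast
  obtain \<rho> where \<rho>: "\<rho> \<in> Bij K" "\<And>x. x \<in> K \<Longrightarrow> \<rho> (\<sigma> x) = x" "\<And>x. x \<in> K \<Longrightarrow> \<sigma> (\<rho> x) = x"
    using Bij_inverse[OF \<sigma>] by blast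
  have C: "\<rho> ` \<sigma> ` C = C"
    using \<rho>(2) \<open>C \<subseteq> K\<close> by (force simp: image_image)
  have inv: "recolor \<rho> (recolor \<sigma> t) = t"
    using recolor_recolor[OF t, of "\<lambda>x. x" \<rho> \<sigma>] recolor_ident[OF t, of "\<lambda>x. x"] \<rho>(2) by simp
  show "flip_class n K (\<sigma> ` C) (recolor \<sigma> t) \<subseteq> recolor \<sigma> ` flip_class n K C t"
  proof
    fix t' assume t': "t' \<in> flip_class n K (\<sigma> ` C) (recolor \<sigma> t)"
    then have "t' \<in> colored_triangulations n K"
      using flip_class_colored recolor_colored[OF \<sigma> t] by blast
    then have "recolor \<sigma> (recolor \<rho> t') = t'"
      using recolor_recolor[of t' n K "\<lambda>x. x" \<sigma> \<rho>] recolor_ident[of t' n K "\<lambda>x. x"] \<rho>(3) by simp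
    moreover have "recolor \<rho> t' \<in> flip_class n K C t"
      using recolor_flip_class_subset[OF \<rho>(1) t'] C inv by simp
    ultimately show "t' \<in> recolor \<sigma> ` flip_class n K C t"
      by (metis imageI)
  qed
qed

section \<open>The group action on the faces\<close>

lemma colorful_faces_cases:
  assumes "F \<in> colorful_faces n K"
  obtains "F = None"
    | C t where "F = colorful_face n K C t" "C \<subseteq> K" "t \<in> colored_triangulations n K"
  using assms unfolding colorful_faces_def by blast

lemma colorful_face_in_faces:
  "C \<subseteq> K \<Longrightarrow> t \<in> colored_triangulations n K \<Longrightarrow> colorful_face n K C t \<in> colorful_faces n K"
  unfolding colorful_faces_def by blast

lemma face_action_None: "face_action n K \<sigma> None = None"
  unfolding face_action_def colorful_faces_def by simp

text \<open>Connects the action on whole classes with its description by a representative.\<close>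

lemma face_action_colorful_face:
  assumes "\<sigma> \<in> Bij K" and "C \<subseteq> K" and "t \<in> colored_triangulations n K"
  shows "face_action n K \<sigma> (colorful_face n K C t) = colorful_face n K (\<sigma> ` C) (recolor \<sigma> t)"
  using colorful_face_in_faces[OF assms(2,3)] recolor_flip_class[OF assms]
  by (simp add: face_action_def colorful_face_def)

lemma Bij_image_subset: "\<sigma> \<in> Bij K \<Longrightarrow> C \<subseteq> K \<Longrightarrow> \<sigma> ` C \<subseteq> K"
  using Bij_imp_funcset by blast

lemma face_action_closed:
  assumes "\<sigma> \<in> Bij K" and "F \<in> colorful_faces n K"
  shows "face_action n K \<sigma> F \<in> colorful_faces n K"
  using assms(2)
proof (cases rule: colorful_faces_cases)
  case (2 C t)
  show ?thesis
    unfolding 2(1) face_action_colorful_face[OF assms(1) 2(2,3)]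
    by (rule colorful_face_in_faces[OF Bij_image_subset[OF assms(1) 2(2)]
      recolor_colored[OF assms(1) 2(3)]])
qed (use assms face_action_None in metis)

lemma face_action_comp:
  assumes "\<sigma> \<in> Bij K" "\<tau> \<in> Bij K" "\<upsilon> \<in> Bij K" "\<And>x. x \<in> K \<Longrightarrow> \<upsilon> x = \<sigma> (\<tau> x)"
    and "F \<in> colorful_faces n K"
  shows "face_action n K \<sigma> (face_action n K \<tau> F) = face_action n K \<upsilon> F"
  using assms(5)
proof (cases rule: colorful_faces_cases)
  case (2 C t)
  have "\<sigma> ` \<tau> ` C = \<upsilon> ` C"
    using assms(4) 2(2) by (auto simp: image_image subset_iff)
  then show ?thesis
    unfolding 2(1)
    using 2 assms recolor_recolor[OF 2(3), of \<upsilon> \<sigma> \<tau>]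
    by (simp add: face_action_colorful_face recolor_colored Bij_image_subset)
qed (simp add: face_action_None)

lemma face_action_ident:
  assumes "\<sigma> \<in> Bij K" "\<And>x. x \<in> K \<Longrightarrow> \<sigma> x = x" and "F \<in> colorful_faces n K"
  shows "face_action n K \<sigma> F = F"
  using assms(3)
proof (cases rule: colorful_faces_cases)
  case (2 C t)
  have "\<sigma> ` C = C"
    using assms(2) 2(2) by (force simp: subset_iff)
  then show ?thesis
    unfolding 2(1)
    using 2 assms recolor_ident[OF 2(3), of \<sigma>] by (simp add: face_action_colorful_face)
qed (simp add: face_action_None)

lemma face_action_inverse:
  assumes "\<sigma> \<in> Bij K" "\<rho> \<in> Bij K" "\<And>x. x \<in> K \<Longrightarrow> \<rho> (\<sigma> x) = x" and F: "F \<in> colorful_faces n K"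
  shows "face_action n K \<rho> (face_action n K \<sigma> F) = F"
proof -
  have "face_action n K \<rho> (face_action n K \<sigma> F) = face_action n K (\<lambda>x\<in>K. x) F"
    by (rule face_action_comp) (use assms id_Bij in auto)
  also have "\<dots> = F"
    by (rule face_action_ident) (use assms id_Bij in auto)
  finally show ?thesis .
qed

lemma face_action_Bij:
  assumes \<sigma>: "\<sigma> \<in> Bij K"
  shows "face_action n K \<sigma> \<in> Bij (colorful_faces n K)"
proof -
  obtain \<rho> where \<rho>: "\<rho> \<in> Bij K" "\<And>x. x \<in> K \<Longrightarrow> \<rho> (\<sigma> x) = x" "\<And>x. x \<in> K \<Longrightarrow> \<sigma> (\<rho> x) = x"
    using Bij_inverse[OF \<sigma>] by blast
  have "bij_betw (face_action n K \<sigma>) (colorful_faces n K) (colorful_faces n K)"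
  proof (rule bij_betw_byWitness)
    show "\<forall>F\<in>colorful_faces n K. face_action n K \<rho> (face_action n K \<sigma> F) = F"
      using face_action_inverse[OF \<sigma> \<rho>(1,2)] by simp
    show "\<forall>F\<in>colorful_faces n K. face_action n K \<sigma> (face_action n K \<rho> F) = F"
      using face_action_inverse[OF \<rho>(1) \<sigma> \<rho>(3)] by simp
  qed (use face_action_closed \<sigma> \<rho>(1) in blast)+
  moreover have "face_action n K \<sigma> \<in> extensional (colorful_faces n K)"
    unfolding face_action_def by simp
  ultimately show ?thesis
    unfolding Bij_def by simp
qed

lemma group_action_face_action:
  "group_action (BijGroup K) (colorful_faces n K) (face_action n K)"
proof (intro group_action.intro group_hom.intro group_hom_axioms.intro group_BijGroup homI)
  fix \<sigma> assume "\<sigma> \<in> carrier (BijGroup K)"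
  then show "face_action n K \<sigma> \<in> carrier (BijGroup (colorful_faces n K))"
    using face_action_Bij by (simp add: BijGroup_def)
next
  fix \<sigma> \<tau> assume "\<sigma> \<in> carrier (BijGroup K)" "\<tau> \<in> carrier (BijGroup K)"
  then have st: "\<sigma> \<in> Bij K" "\<tau> \<in> Bij K" by (auto simp: BijGroup_def)
  have "face_action n K (compose K \<sigma> \<tau>) =
    compose (colorful_faces n K) (face_action n K \<sigma>) (face_action n K \<tau>)"
  proof (rule extensionalityI)
    show "face_action n K (compose K \<sigma> \<tau>) \<in> extensional (colorful_faces n K)"
      unfolding face_action_def by simp
    show "compose (colorful_faces n K) (face_action n K \<sigma>) (face_action n K \<tau>)
      \<in> extensional (colorful_faces n K)"
      by simp
    fix F assume F: "F \<in> colorful_faces n K"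
    show "face_action n K (compose K \<sigma> \<tau>) F =
      compose (colorful_faces n K) (face_action n K \<sigma>) (face_action n K \<tau>) F"
      using face_action_comp[OF st compose_Bij[OF st] _ F] F by (simp add: compose_eq)
  qed
  then show "face_action n K (\<sigma> \<otimes>\<^bsub>BijGroup K\<^esub> \<tau>) =
    face_action n K \<sigma> \<otimes>\<^bsub>BijGroup (colorful_faces n K)\<^esub> face_action n K \<tau>"
    using st face_action_Bij[OF st(1), of n] face_action_Bij[OF st(2), of n]
    by (simp add: BijGroup_def)
qed

lemma face_action_mono:
  assumes "\<sigma> \<in> Bij K" and "(F, F') \<in> colorful_order n K"
  shows "(face_action n K \<sigma> F, face_action n K \<sigma> F') \<in> colorful_order n K"
proof -
  have F: "F \<in> colorful_faces n K" "F' \<in> colorful_faces n K"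
    using assms(2) by (auto simp: colorful_order_def)
  have "face_action n K \<sigma> F = None \<or> (\<exists>C X C' X'. face_action n K \<sigma> F = Some (C, X) \<and>
    face_action n K \<sigma> F' = Some (C', X') \<and> C \<subseteq> C' \<and> X \<subseteq> X')"
    using assms(2) F unfolding colorful_order_def face_action_def by (auto simp: image_mono)
  then show ?thesis
    unfolding colorful_order_def using face_action_closed[OF assms(1)] F by blast
qed

lemma face_action_poset_iso:
  assumes \<sigma>: "\<sigma> \<in> Bij K"
  shows "poset_iso (colorful_faces n K) (colorful_order n K)
    (colorful_faces n K) (colorful_order n K) (face_action n K \<sigma>)"
proof -
  obtain \<rho> where \<rho>: "\<rho> \<in> Bij K" "\<And>x. x \<in> K \<Longrightarrow> \<rho> (\<sigma> x) = x"
    using Bij_inverse[OF \<sigma>] by blast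
  have "(F, F') \<in> colorful_order n K \<longleftrightarrow>
      (face_action n K \<sigma> F, face_action n K \<sigma> F') \<in> colorful_order n K"
    if "F \<in> colorful_faces n K" "F' \<in> colorful_faces n K" for F F'
    using face_action_mono[OF \<sigma>, of F F' n] face_action_inverse[OF \<sigma> \<rho>] that
      face_action_mono[OF \<rho>(1), of "face_action n K \<sigma> F" "face_action n K \<sigma> F'" n] by auto
  then show ?thesis
    using face_action_Bij[OF \<sigma>, of n] unfolding poset_iso_def Bij_def by blast
qed

section \<open>Triangulations of a colorful face\<close>

text \<open>The orbit invariant that induces the isomorphism: the vertex set of the corresponding
  ordinary face, hence empty for the least element.\<close>

definition face_triangulations :: "'c colorful_face \<Rightarrow> nat set set set"
  where "face_triangulations F = (case F of None \<Rightarrow> {} | Some (C, X) \<Rightarrow> dom ` X)"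

lemma face_triangulations_None [simp]: "face_triangulations None = {}"
  unfolding face_triangulations_def by simp

lemma face_triangulations_colorful_face:
  assumes "t \<in> colored_triangulations n K"
  shows "face_triangulations (colorful_face n K C t) =
    {T \<in> triangulations n. fixed_diagonals t C \<subseteq> T}"
  unfolding face_triangulations_def colorful_face_def using dom_flip_class[OF assms] by simp

lemma dom_in_face_triangulations: "dom t \<in> face_triangulations (colorful_face n K C t)"
  using flip_class_refl by (fastforce simp: face_triangulations_def colorful_face_def)

lemma face_triangulations_action:
  "F \<in> colorful_faces n K \<Longrightarrow> face_triangulations (face_action n K \<sigma> F) = face_triangulations F"
  by (auto simp: face_triangulations_def face_action_def image_image split: option.split)

lemma face_triangulations_mono:
  "(F, F') \<in> colorful_order n K \<Longrightarrow> face_triangulations F \<subseteq> face_triangulations F'"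
  unfolding colorful_order_def face_triangulations_def by (fastforce simp: image_mono)

text \<open>An injective coloring of \<open>n\<close> diagonals by \<open>n\<close> colors uses
  every color.\<close>

lemma coloring_bij_betw:
  assumes t: "t \<in> colored_triangulations n K" and "finite K" "card K = n"
  shows "bij_betw (the \<circ> t) (dom t) K"
proof -
  note T = colored_triangulations_dom[OF t]
  have inj: "inj_on (the \<circ> t) (dom t)"
  proof (rule inj_onI)
    fix d d' assume "d \<in> dom t" "d' \<in> dom t" and eq: "(the \<circ> t) d = (the \<circ> t) d'"
    then obtain c c' where "t d = Some c" "t d' = Some c'" by blast
    then show "d = d'" using eq coloring_inj[OF t, of d c d'] by simp
  qed
  moreover have "(the \<circ> t) ` dom t \<subseteq> K"
    using t unfolding colored_triangulations_def by (auto dest: ranI)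
  moreover have "card ((the \<circ> t) ` dom t) = card K"
    using card_image[OF inj] card_triangulation[OF T] assms(3) by simp
  ultimately show ?thesis
    using card_subset_eq[OF assms(2)] unfolding bij_betw_def by blast
qed

lemma recolor_transitive:
  assumes t: "t \<in> colored_triangulations n K" and t': "t' \<in> colored_triangulations n K"
    and dom: "dom t = dom t'" and K: "finite K" "card K = n"
  obtains \<sigma> where "\<sigma> \<in> Bij K" "recolor \<sigma> t' = t"
proof -
  let ?h = "inv_into (dom t') (the \<circ> t')"
  \<comment> \<open>The color that a diagonal has in \<open>t'\<close> is sent to the color that it
    has in \<open>t\<close>.\<close>
  define \<sigma> where "\<sigma> = restrict ((the \<circ> t) \<circ> ?h) K"
  have b: "bij_betw (the \<circ> t) (dom t) K" "bij_betw (the \<circ> t') (dom t') K"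
    using coloring_bij_betw t t' K by auto
  have "bij_betw ((the \<circ> t) \<circ> ?h) K K"
    using bij_betw_trans[OF bij_betw_inv_into[OF b(2)]] b(1) dom by metis
  then have "\<sigma> \<in> Bij K"
    unfolding \<sigma>_def Bij_def by simp
  moreover have "recolor \<sigma> t' d = t d" for d
  proof (cases "d \<in> dom t'")
    case True
    then have "?h (the (t' d)) = d" "the (t' d) \<in> K"
      using bij_betw_inv_into_left[OF b(2) True] bij_betwE[OF b(2)] by auto
    then have "\<sigma> (the (t' d)) = the (t d)"
      unfolding \<sigma>_def by simp
    then show ?thesis
      using True domD[of d t] dom by (auto simp: recolor_def)
  next
    case False
    then show ?thesis using dom by (metis dom_recolor domIff)
  qed
  ultimately show ?thesis using that by blast
qed

text \<open>Each \<open>c \<in> C\<close> occurs on some diagonal \<open>d\<close>. If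
  \<open>c\<close> were outside of \<open>C'\<close>, then \<open>d\<close> would be fixed for
  \<open>C'\<close> and hence for \<open>C\<close>, although its color lies in
  \<open>C\<close>.\<close>

lemma colors_subset_if_fixed_subset:
  assumes t: "t \<in> colored_triangulations n K" and K: "finite K" "card K = n"
    and C: "C \<subseteq> K" and sub: "fixed_diagonals t C' \<subseteq> fixed_diagonals t C"
  shows "C \<subseteq> C'"
proof
  fix c assume "c \<in> C"
  then obtain d where "d \<in> dom t" "c = the (t d)"
    using coloring_bij_betw[OF t K] C unfolding bij_betw_def by force
  then have "t d = Some c" by auto
  then show "c \<in> C'"
    using \<open>c \<in> C\<close> sub unfolding fixed_diagonals_def by fastforce
qed

text \<open>The triangulation of a representative \<open>t\<close> of \<open>F\<close> also
  underlies some representative of \<open>F'\<close>, and a permutation of the colors turns the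
  latter into \<open>t\<close>. Afterwards both faces share \<open>t\<close>, so only their color
  sets remain to be compared. One \<open>\<sigma>\<close> serves both conclusions: the first gives
  the order on orbits, the second the injectivity.\<close>

lemma face_triangulations_subsetD:
  assumes K: "finite K" "card K = n"
    and F: "F \<in> colorful_faces n K" and F': "F' \<in> colorful_faces n K"
    and sub: "face_triangulations F \<subseteq> face_triangulations F'"
  obtains \<sigma> where "\<sigma> \<in> Bij K" "(F, face_action n K \<sigma> F') \<in> colorful_order n K"
    "face_triangulations F = face_triangulations F' \<Longrightarrow> F = face_action n K \<sigma> F'"
  using F
proof (cases rule: colorful_faces_cases)
  case 1
  \<comment> \<open>Below the least face any permutation would do, and the identity is taken. In the
    case of equality, only \<open>None\<close> has no triangulations.\<close>
  have none: "F' = None" if "face_triangulations F' = {}"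
    using F'
  proof (cases rule: colorful_faces_cases)
    case (2 C t)
    then show ?thesis using that dom_in_face_triangulations[of t n K C] by simp
  qed
  have "(F, face_action n K (\<lambda>x\<in>K. x) F') \<in> colorful_order n K"
    using 1 F face_action_closed[OF id_Bij F'] unfolding colorful_order_def by blast
  moreover have "F = face_action n K (\<lambda>x\<in>K. x) F'"
    if "face_triangulations F = face_triangulations F'"
    using none that 1 by (simp add: face_action_None)
  ultimately show ?thesis
    using that[OF id_Bij] by blast
next
  case (2 C t)
  have domt: "dom t \<in> face_triangulations F'"
    using dom_in_face_triangulations sub 2(1) by blast
  from F' show ?thesis
  proof (cases rule: colorful_faces_cases)
    case 1
    then show ?thesis using domt by simp
  next
    case F': (2 C' t0)
    obtain t' where t': "t' \<in> flip_class n K C' t0" "dom t = dom t'"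
      using domt unfolding F'(1) face_triangulations_def colorful_face_def by auto
    have t'c: "t' \<in> colored_triangulations n K"
      using flip_class_colored t'(1) F'(3) by blast
    obtain \<sigma> where \<sigma>: "\<sigma> \<in> Bij K" "recolor \<sigma> t' = t"
      using recolor_transitive[OF 2(3) t'c t'(2) K] by blast
    let ?C = "\<sigma> ` C'"
    have "F' = colorful_face n K C' t'"
      unfolding F'(1) colorful_face_def flip_class_eq[OF t'(1)] ..
    then have act: "face_action n K \<sigma> F' = colorful_face n K ?C t"
      using face_action_colorful_face[OF \<sigma>(1) F'(2) t'c] \<sigma>(2) by simp
    have ft: "face_triangulations F = {T \<in> triangulations n. fixed_diagonals t C \<subseteq> T}"
      "face_triangulations F' = {T \<in> triangulations n. fixed_diagonals t ?C \<subseteq> T}"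
      using face_triangulations_colorful_face[OF 2(3)] 2(1) act
        face_triangulations_action[OF \<open>F' \<in> colorful_faces n K\<close>] by metis+
    note nc = fixed_diagonals_noncrossing[OF 2(3)]
    \<comment> \<open>Two reversals: fewer triangulations mean more fixed diagonals, and these mean
      fewer colors.\<close>
    have CC: "C \<subseteq> ?C"
      by (rule colors_subset_if_fixed_subset[OF 2(3) K 2(2)], rule triangulations_supset_mono[OF nc])
        (use sub ft in simp)
    have "(F, face_action n K \<sigma> F') \<in> colorful_order n K"
      using F face_action_closed[OF \<sigma>(1) \<open>F' \<in> colorful_faces n K\<close>] CC flip_class_mono[OF CC]
      unfolding colorful_order_def act 2(1) colorful_face_def by auto
    moreover have "F = face_action n K \<sigma> F'" if "face_triangulations F = face_triangulations F'"
    proof -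
      have "?C \<subseteq> C"
        by (rule colors_subset_if_fixed_subset[OF 2(3) K Bij_image_subset[OF \<sigma>(1) F'(2)]],
            rule triangulations_supset_mono[OF nc]) (use that ft in simp)
      then show ?thesis
        using CC act 2(1) by simp
    qed
    ultimately show ?thesis
      using that \<sigma>(1) by blast
  qed
qed

lemma face_triangulations_in_faces:
  assumes "F \<in> colorful_faces n K"
  shows "face_triangulations F \<in> associahedron_faces n"
  using assms
proof (cases rule: colorful_faces_cases)
  case (2 C t)
  note T = colored_triangulations_dom[OF 2(3)]
  let ?D = "fixed_diagonals t C"
  have "card ?D \<le> n"
    using card_mono[OF finite_noncrossing[OF triangulation_noncrossing[OF T]] fixed_diagonals_subset]
      card_triangulation[OF T] by simp
  \<comment> \<open>The witness is \<open>j = n - card ?D\<close>; by the bound on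
    \<open>card ?D\<close> the truncated subtraction is exact.\<close>
  then have "n - card ?D \<le> n" "card ?D = n - (n - card ?D)"
    by simp_all
  then show ?thesis
    unfolding 2(1) face_triangulations_colorful_face[OF 2(3)] associahedron_faces_def
    using fixed_diagonals_noncrossing[OF 2(3)] by blast
qed (simp add: associahedron_faces_def)

text \<open>Extend \<open>D\<close> to a triangulation \<open>T\<close>, color \<open>T\<close> by
  any bijection with \<open>K\<close>, and let the colors of \<open>T - D\<close> be the flippable
  ones. The empty face comes from \<open>None\<close>.\<close>

lemma associahedron_face_lift:
  assumes K: "finite K" "card K = n" and \<Phi>: "\<Phi> \<in> associahedron_faces n"
  obtains F where "F \<in> colorful_faces n K" "face_triangulations F = \<Phi>"
proof (cases "\<Phi> = {}")
  case True
  then show ?thesis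
    using that[of None] by (simp add: colorful_faces_def)
next
  case False
  then obtain D where D: "D \<in> noncrossing_sets n" "\<Phi> = {T \<in> triangulations n. D \<subseteq> T}"
    using \<Phi> unfolding associahedron_faces_def by blast
  obtain T where T: "T \<in> triangulations n" "D \<subseteq> T"
    using noncrossing_extends[OF D(1)] by blast
  obtain h where h: "bij_betw h T K"
    using finite_same_card_bij[of T K] K card_triangulation[OF T(1)]
      finite_noncrossing[OF triangulation_noncrossing[OF T(1)]] by auto
  define t where "t = (\<lambda>d. if d \<in> T then Some (h d) else None)"
  have "dom t = T" "ran t \<subseteq> K" "inj_on t T"
    using h unfolding t_def bij_betw_def by (auto simp: dom_def ran_def inj_on_def split: if_splits)
  then have t: "t \<in> colored_triangulations n K"
    using T unfolding colored_triangulations_def by simp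
  have "h ` (T - D) \<subseteq> K"
    using h unfolding bij_betw_def by blast
  moreover have "fixed_diagonals t (h ` (T - D)) = D"
    using h T unfolding fixed_diagonals_def t_def bij_betw_def inj_on_def by (auto split: if_splits)
  ultimately show ?thesis
    using that colorful_face_in_faces[OF _ t] face_triangulations_colorful_face[OF t] D(2) by metis
qed

text \<open>Antisymmetry and transitivity are not visible from the existential definition of
  \<open>quotient_order\<close>; they are pulled back along the isomorphism.\<close>

lemma partial_order_on_poset_iso:
  assumes iso: "poset_iso A r B s f" and s: "partial_order_on B s" and r: "r \<subseteq> A \<times> A"
  shows "partial_order_on A r"
proof -
  have inj: "inj_on f A" and f: "\<And>x. x \<in> A \<Longrightarrow> f x \<in> B"
    and rs: "\<And>x y. x \<in> A \<Longrightarrow> y \<in> A \<Longrightarrow> (x, y) \<in> r \<longleftrightarrow> (f x, f y) \<in> s"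
    using iso unfolding poset_iso_def bij_betw_def by auto
  have "refl_on B s" "trans s" "antisym s"
    using s unfolding partial_order_on_def preorder_on_def by auto
  then have "refl_on A r" "trans r" "antisym r"
    using r f rs inj_onD[OF inj] unfolding refl_on_def trans_def antisym_def
    by (blast, smt (verit) mem_Sigma_iff subset_iff, smt (verit) mem_Sigma_iff subset_iff)
  then show ?thesis
    using r unfolding partial_order_on_def preorder_on_def by blast
qed

lemma partial_order_associahedron: "partial_order_on (associahedron_faces n) (associahedron_order n)"
  unfolding partial_order_on_def preorder_on_def refl_on_def trans_def antisym_def
    associahedron_order_def by auto

section \<open>Orbits of faces and the quotient poset\<close>

lemma quotient_faces_cases:
  assumes "P \<in> quotient_faces n K"
  obtains F where "F \<in> colorful_faces n K" "P = orbit (BijGroup K) (face_action n K) F"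
  using assms unfolding quotient_faces_def orbits_def by blast

lemma orbit_iff:
  "G \<in> orbit (BijGroup K) (face_action n K) F \<longleftrightarrow> (\<exists>\<sigma>\<in>Bij K. G = face_action n K \<sigma> F)"
  unfolding orbit_def BijGroup_def by auto

text \<open>The union avoids the choice of a representative: all faces in an orbit contribute the
  same set.\<close>

definition orbit_triangulations :: "'c colorful_face set \<Rightarrow> nat set set set"
  where "orbit_triangulations P = \<Union> (face_triangulations ` P)"

lemma self_in_orbit:
  assumes "F \<in> colorful_faces n K"
  shows "F \<in> orbit (BijGroup K) (face_action n K) F"
  unfolding orbit_iff
  using face_action_ident[OF id_Bij _ assms] by (intro bexI[OF _ id_Bij]) simp

lemma orbit_triangulations:
  assumes F: "F \<in> colorful_faces n K"
  shows "orbit_triangulations (orbit (BijGroup K) (face_action n K) F) = face_triangulations F"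
proof
  show "orbit_triangulations (orbit (BijGroup K) (face_action n K) F) \<subseteq> face_triangulations F"
    using face_triangulations_action[OF F] unfolding orbit_triangulations_def
    by (auto simp: orbit_iff)
  show "face_triangulations F \<subseteq> orbit_triangulations (orbit (BijGroup K) (face_action n K) F)"
    unfolding orbit_triangulations_def using self_in_orbit[OF F] by blast
qed

lemma quotient_poset_iso:
  assumes K: "finite K" "card K = n"
  shows "poset_iso (quotient_faces n K) (quotient_order n K)
    (associahedron_faces n) (associahedron_order n) orbit_triangulations"
proof -
  let ?orb = "orbit (BijGroup K) (face_action n K)"
  have orb: "?orb F \<in> quotient_faces n K" if "F \<in> colorful_faces n K" for F
    using that unfolding quotient_faces_def orbits_def by blast
  have "inj_on orbit_triangulations (quotient_faces n K)"
  proof (rule inj_onI)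
    fix P Q assume P: "P \<in> quotient_faces n K" and Q: "Q \<in> quotient_faces n K"
      and eq: "orbit_triangulations P = orbit_triangulations Q"
    obtain F where F: "F \<in> colorful_faces n K" "P = ?orb F"
      using P by (rule quotient_faces_cases)
    obtain G where G: "G \<in> colorful_faces n K" "Q = ?orb G"
      using Q by (rule quotient_faces_cases)
    have "face_triangulations F = face_triangulations G"
      using eq F G orbit_triangulations by metis
    then obtain \<sigma> where "\<sigma> \<in> Bij K" "F = face_action n K \<sigma> G"
      using face_triangulations_subsetD[OF K F(1) G(1)] by blast
    then have "F \<in> ?orb G"
      using orbit_iff by blast
    then show "P = Q"
      \<comment> \<open>Distinct orbits are disjoint, and \<open>F\<close> lies in both of
        these.\<close>
      using group_action.disjoint_union[OF group_action_face_action
          P[unfolded quotient_faces_def] Q[unfolded quotient_faces_def]] F G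
        self_in_orbit[OF F(1)] by blast
  qed
  moreover have "orbit_triangulations ` quotient_faces n K = associahedron_faces n"
  proof
    show "orbit_triangulations ` quotient_faces n K \<subseteq> associahedron_faces n"
      using quotient_faces_cases orbit_triangulations face_triangulations_in_faces
      by (metis image_subsetI)
    show "associahedron_faces n \<subseteq> orbit_triangulations ` quotient_faces n K"
    proof
      fix \<Phi> assume "\<Phi> \<in> associahedron_faces n"
      then obtain F where "F \<in> colorful_faces n K" "face_triangulations F = \<Phi>"
        using associahedron_face_lift[OF K] by blast
      then show "\<Phi> \<in> orbit_triangulations ` quotient_faces n K"
        using orb orbit_triangulations by (metis imageI)
    qed
  qed
  moreover have "(P, Q) \<in> quotient_order n K \<longleftrightarrow>
      (orbit_triangulations P, orbit_triangulations Q) \<in> associahedron_order n"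
    if P: "P \<in> quotient_faces n K" and Q: "Q \<in> quotient_faces n K" for P Q
  proof -
    obtain F where F: "F \<in> colorful_faces n K" "P = ?orb F"
      using P by (rule quotient_faces_cases)
    obtain G where G: "G \<in> colorful_faces n K" "Q = ?orb G"
      using Q by (rule quotient_faces_cases)
    have ft: "orbit_triangulations P = face_triangulations F"
      "orbit_triangulations Q = face_triangulations G"
      using F G orbit_triangulations by metis+
    have "face_triangulations F \<subseteq> face_triangulations G" if "(P, Q) \<in> quotient_order n K"
    proof -
      obtain F' G' where "F' \<in> P" "G' \<in> Q" "(F', G') \<in> colorful_order n K"
        using \<open>(P, Q) \<in> quotient_order n K\<close> unfolding quotient_order_def by blast
      then show ?thesis
        using face_triangulations_mono face_triangulations_action F G orbit_iff by metis
    qed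
    moreover have "(P, Q) \<in> quotient_order n K" if sub: "face_triangulations F \<subseteq> face_triangulations G"
    proof -
      \<comment> \<open>Moving \<open>G\<close> within its orbit places it above the given
        \<open>F\<close>.\<close>
      obtain \<sigma> where "\<sigma> \<in> Bij K" "(F, face_action n K \<sigma> G) \<in> colorful_order n K"
        using face_triangulations_subsetD[OF K F(1) G(1) sub] by blast
      moreover have "F \<in> P" "face_action n K \<sigma> G \<in> Q"
        using self_in_orbit F G orbit_iff \<open>\<sigma> \<in> Bij K\<close> by blast+
      ultimately show ?thesis
        unfolding quotient_order_def using P Q by blast
    qed
    ultimately show ?thesis
      unfolding ft associahedron_order_def using face_triangulations_in_faces F G by blast
  qed
  ultimately show ?thesis
    unfolding poset_iso_def bij_betw_def by blast
qed

theorem theorem5: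
  fixes n :: nat and K :: "'c set"
  assumes "finite K" and "card K = n"
  shows "group_action (BijGroup K) (colorful_faces n K) (face_action n K)
    \<and> (\<forall>\<sigma>\<in>carrier (BijGroup K).
         face_action n K \<sigma> None = None
         \<and> (\<forall>C t. C \<subseteq> K \<and> t \<in> colored_triangulations n K \<longrightarrow>
              recolor \<sigma> t \<in> colored_triangulations n K
              \<and> face_action n K \<sigma> (colorful_face n K C t) = colorful_face n K (\<sigma> ` C) (recolor \<sigma> t))
         \<and> poset_iso (colorful_faces n K) (colorful_order n K)
              (colorful_faces n K) (colorful_order n K) (face_action n K \<sigma>))
    \<and> partial_order_on (quotient_faces n K) (quotient_order n K)
    \<and> (\<exists>f. poset_iso (quotient_faces n K) (quotient_order n K)
              (associahedron_faces n) (associahedron_order n) f)"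
proof (intro conjI ballI)
  show "group_action (BijGroup K) (colorful_faces n K) (face_action n K)"
    by (rule group_action_face_action)
next
  fix \<sigma> assume "\<sigma> \<in> carrier (BijGroup K)"
  then have \<sigma>: "\<sigma> \<in> Bij K" by (simp add: BijGroup_def)
  show "face_action n K \<sigma> None = None"
    by (rule face_action_None)
  show "\<forall>C t. C \<subseteq> K \<and> t \<in> colored_triangulations n K \<longrightarrow>
    recolor \<sigma> t \<in> colored_triangulations n K
    \<and> face_action n K \<sigma> (colorful_face n K C t) = colorful_face n K (\<sigma> ` C) (recolor \<sigma> t)"
    using recolor_colored[OF \<sigma>] face_action_colorful_face[OF \<sigma>] by blast
  show "poset_iso (colorful_faces n K) (colorful_order n K)
    (colorful_faces n K) (colorful_order n K) (face_action n K \<sigma>)"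
    using \<sigma> by (rule face_action_poset_iso)
next
  note iso = quotient_poset_iso[OF assms]
  show "partial_order_on (quotient_faces n K) (quotient_order n K)"
    by (rule partial_order_on_poset_iso[OF iso partial_order_associahedron])
      (auto simp: quotient_order_def)
  show "\<exists>f. poset_iso (quotient_faces n K) (quotient_order n K)
    (associahedron_faces n) (associahedron_order n) f"
    using iso by blast
qed

end
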